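(* Let $f$ be a transcendental self-map of $\mathbb{C}^*$. Then: (i) the escaping set $I(f)$ is a $\mathbb{C}^*$-spider's web if and only if $I(f)$ separates some point of $J(f)$ from $\{0,\infty\}$; (ii) the fast escaping set $A(f)$ is a $\mathbb{C}^*$-spider's web if and only if $A(f)$ separates some point of $J(f)$ from $\{0,\infty\}$; (iii) the Julia set $J(f)$ is a $\mathbb{C}^*$-spider's web if and only if $J(f)$ separates some point of $J(f)$ from $\{0,\infty\}$.
   Context: $\mathbb{C}^* := \mathbb{C}\setminus\{0\}$ and $\widehat{\mathbb{C}} := \mathbb{C}\cup\{\infty\}$. Boundaries are taken in $\mathbb{C}$ unless otherwise stated. A transcendental self-map of $\mathbb{C}^*$ is a holomorphic function $f:\mathbb{C}^*\to\mathbb{C}^*$ for which both $0$ and $\infty$ are essential singularities. The Fatou set $F(f)$ is the set of $z\in\mathbb{C}^*$ having an open neighbourhood on which $\{f^n\}_{n\in\mathbb{N}}$ is a normal family; the Julia set is $J(f):=\mathbb{C}^*\setminus F(f)$. Escaping set: $I(f):=\{z\in\mathbb{C}^*:\omega(z,f)\subset\{0,\infty\}\}$, where $\omega(z,f):=\bigcap_{n\in\mathbb{N}}\overline{\{f^k(z):k\geq n\}}$ with closure taken in $\widehat{\mathbb{C}}$. Fast escaping set: let $M(r):=\max_{|z|=r}|f(z)|$ and $m(r):=\min_{|z|=r}|f(z)|$ for $r>0$. Fix $R>1$ sufficiently large (the resulting set does not depend on the choice). For a sequence $e=(e_n)_{n\geq0}\in\{0,\infty\}^{\mathbb{N}\cup\{0\}}$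 define positive numbers $R_n=R_n(e)$ by $R_0=R$ if $e_0=\infty$, $R_0=1/R$ if $e_0=0$, and, for $n\geq 1$, $R_n=M(R_{n-1})$ if $e_n=\infty$, $R_n=m(R_{n-1})$ if $e_n=0$. Then $A(f)$ is the set of $z\in\mathbb{C}^*$ for which there exist $\ell\geq0$ and a sequence $e$ such that, for all $n\geq0$, $|f^{n+\ell}(z)|\geq R_n(e)$ if $e_n=\infty$ and $|f^{n+\ell}(z)|\leq R_n(e)$ if $e_n=0$. A set $X\subset\mathbb{C}^*$ is bounded in $\mathbb{C}^*$ if its closure in $\widehat{\mathbb{C}}$ does not meet $\{0,\infty\}$. $\mathbb{C}^*$-spider's web: a set $E\subset\mathbb{C}^*$ is a $\mathbb{C}^*$-spider's web if $E$ is connected and there exists a sequence of domains $(G_n')_{n\in\mathbb{N}}$, each bounded in $\mathbb{C}^*$, such that (a) each $G_n'$ is doubly connected and separates $0$ from $\infty$ (so $\widehat{\mathbb{C}}\setminus G_n'$ has exactly two components, one containing $0$ and the other containing $\infty$); (b) $G_n'\subset G_{n+1}'$ and $\partial G_n'\subset E$ for $n\in\mathbb{N}$; (c) $\bigcup_{n\in\mathbb{N}}G_n'=\mathbb{C}^*$. Separation: $E$ separates a point $z$ from $X\subset\widehat{\mathbb{C}}$ if there is an open set $U$ containing $z$ such that the closure of $U$ in $\widehat{\mathbb{C}}$ does not meet $X$ and $\partial U\subset E$. *)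

theory Defs
  imports "HOL-Complex_Analysis.Complex_Analysis"
begin

section \<open>The Riemann sphere\<close>

text \<open>
  The extended plane is modelled as the unit sphere of \<^typ>\<open>complex \<times> real\<close>, into which the
  plane is embedded by inverse stereographic projection from the north pole. Closures and
  components in the extended plane are thus those of the ambient Euclidean space, and the
  Euclidean distance on the sphere is the chordal metric.
\<close>

definition riemann_sphere :: "(complex \<times> real) set" where
  "riemann_sphere = sphere 0 1"

definition to_sphere :: "complex \<Rightarrow> complex \<times> real" where
  "to_sphere z =
     ((2 / (1 + (cmod z)\<^sup>2)) *\<^sub>R z, ((cmod z)\<^sup>2 - 1) / (1 + (cmod z)\<^sup>2))"

definition sphere_infinity :: "complex \<times> real" where
  "sphere_infinity = (0, 1)"

lemma one_plus_cmod_sq_pos: "1 + (cmod z)\<^sup>2 > 0"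
  by (simp add: add_pos_nonneg)

lemma norm_to_sphere: "norm (to_sphere z) = 1"
proof -
  define t where "t = (cmod z)\<^sup>2"
  have t: "1 + t > 0" unfolding t_def by (rule one_plus_cmod_sq_pos)
  have "(norm (to_sphere z))\<^sup>2 = (2 / (1 + t))\<^sup>2 * t + ((t - 1) / (1 + t))\<^sup>2"
    unfolding to_sphere_def norm_Pair t_def by (simp add: power_mult_distrib power_divide)
  also have "\<dots> = (4 * t + (t - 1)\<^sup>2) / (1 + t)\<^sup>2"
    by (simp add: power_divide add_divide_distrib)
  also have "4 * t + (t - 1)\<^sup>2 = (1 + t)\<^sup>2"
    by (simp add: power2_eq_square algebra_simps)
  finally have "(norm (to_sphere z))\<^sup>2 = 1" using t by simp
  then show ?thesis by (simp add: power2_eq_1_iff)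
      (metis norm_ge_zero neg_0_le_iff_le not_one_le_zero)
qed

lemma homeomorphism_to_sphere:
  "homeomorphism UNIV (riemann_sphere - {sphere_infinity}) to_sphere
     (\<lambda>(w, t). w /\<^sub>R (1 - t))"
proof -
  have nz: "1 + (cmod z)\<^sup>2 \<noteq> 0" for z using one_plus_cmod_sq_pos[of z] by linarith
  have inv1: "(\<lambda>(w, t). w /\<^sub>R (1 - t)) (to_sphere z) = z" for z
  proof -
    have "1 - ((cmod z)\<^sup>2 - 1) / (1 + (cmod z)\<^sup>2) = 2 / (1 + (cmod z)\<^sup>2)"
      using nz[of z] by (simp add: field_simps)
    moreover have "inverse (2 / (1 + (cmod z)\<^sup>2)) * (2 / (1 + (cmod z)\<^sup>2)) = 1"
      using nz[of z] by (intro left_inverse) simp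
    ultimately show ?thesis by (simp only: to_sphere_def case_prod_conv scaleR_scaleR scaleR_one)
  qed
  have ne: "to_sphere z \<noteq> sphere_infinity" for z
    using nz[of z] by (auto simp: to_sphere_def sphere_infinity_def field_simps)
  have im: "to_sphere z \<in> riemann_sphere - {sphere_infinity}" for z
    using ne[of z] norm_to_sphere[of z] by (simp add: riemann_sphere_def)
  have fact: "t < 1 \<and> (cmod w)\<^sup>2 = (1 - t) * (1 + t)"
    if "(w, t) \<in> riemann_sphere - {sphere_infinity}" for w t
  proof -
    have "sqrt ((cmod w)\<^sup>2 + t\<^sup>2) = 1" using that by (simp add: riemann_sphere_def norm_Pair)
    then have e: "(cmod w)\<^sup>2 + t\<^sup>2 = 1" by simp
    then have "t\<^sup>2 \<le> 1" using zero_le_power2[of "cmod w"] by linarith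
    then have "t \<le> 1" by (simp add: abs_square_le_1 abs_le_iff)
    moreover have "t \<noteq> 1" using e that by (auto simp: sphere_infinity_def)
    ultimately show ?thesis using e by (simp add: power2_eq_square algebra_simps)
  qed
  have inv2: "to_sphere (w /\<^sub>R (1 - t)) = (w, t)"
    if "(w, t) \<in> riemann_sphere - {sphere_infinity}" for w t
  proof -
    from fact[OF that] have t: "1 - t \<noteq> 0" and w: "(cmod w)\<^sup>2 = (1 - t) * (1 + t)" by auto
    have "(cmod (w /\<^sub>R (1 - t)))\<^sup>2 = (cmod w)\<^sup>2 / (1 - t)\<^sup>2"
      by (simp add: power_mult_distrib divide_inverse power_inverse)
    also have "\<dots> = (1 + t) / (1 - t)" using t w by (simp add: power2_eq_square)
    finally have q: "(cmod (w /\<^sub>R (1 - t)))\<^sup>2 = (1 + t) / (1 - t)" .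
    have a: "1 + (1 + t) / (1 - t) = 2 / (1 - t)" "(1 + t) / (1 - t) - 1 = 2 * t / (1 - t)"
      using t by (simp_all add: field_simps)
    have "2 / (2 / (1 - t)) * inverse (1 - t) = 1" using t by (simp add: field_simps)
    then show ?thesis
      unfolding to_sphere_def q a scaleR_scaleR using t by (simp only: scaleR_one) simp
  qed
  show ?thesis
    unfolding homeomorphism_def
  proof (intro conjI ballI)
    show "continuous_on UNIV to_sphere"
      unfolding to_sphere_def using nz by (intro continuous_intros) auto
    show "continuous_on (riemann_sphere - {sphere_infinity}) (\<lambda>(w, t). w /\<^sub>R (1 - t))"
      unfolding case_prod_unfold using fact by (intro continuous_intros) fastforce
    show "to_sphere ` UNIV = riemann_sphere - {sphere_infinity}"
    proof (intro equalityI subsetI)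
      fix p assume "p \<in> riemann_sphere - {sphere_infinity}"
      then show "p \<in> range to_sphere" by (cases p) (metis inv2 rangeI)
    next
      fix p assume "p \<in> range to_sphere"
      then obtain z where "p = to_sphere z" by (rule rangeE)
      then show "p \<in> riemann_sphere - {sphere_infinity}" using im[of z] by (simp only:)
    qed
    show "(\<lambda>(w, t). w /\<^sub>R (1 - t)) ` (riemann_sphere - {sphere_infinity}) = UNIV"
      using im inv1 by (metis (no_types, lifting) UNIV_eq_I image_eqI)
  qed (use inv1 inv2 in auto)
qed


section \<open>Transcendental self-maps of the punctured plane\<close>

abbreviation punctured_plane :: "complex set" where
  "punctured_plane \<equiv> - {0}"

definition essential_singularity_at :: "(complex \<Rightarrow> complex) \<Rightarrow> complex \<Rightarrow> bool" where
  "essential_singularity_at f z \<longleftrightarrow> isolated_singularity_at f z \<and> \<not> not_essential f z"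

text \<open>The value of \<open>f\<close> at \<open>0\<close> is irrelevant, here and below.\<close>

definition transcendental_self_map :: "(complex \<Rightarrow> complex) \<Rightarrow> bool" where
  "transcendental_self_map f \<longleftrightarrow>
     f holomorphic_on punctured_plane \<and> f ` punctured_plane \<subseteq> punctured_plane \<and>
     essential_singularity_at f 0 \<and> essential_singularity_at (\<lambda>w. f (1 / w)) 0"


section \<open>Fatou and Julia sets\<close>

text \<open>
  Normality is with respect to the chordal metric, so that locally uniform convergence to
  infinity is allowed.
\<close>

definition normal_family_on :: "complex set \<Rightarrow> (complex \<Rightarrow> complex) set \<Rightarrow> bool" where
  "normal_family_on U \<F> \<longleftrightarrow>
     (\<forall>s :: nat \<Rightarrow> complex \<Rightarrow> complex. range s \<subseteq> \<F> \<longrightarrow>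
        (\<exists>(r :: nat \<Rightarrow> nat) g. strict_mono r \<and>
           (\<forall>K. compact K \<and> K \<subseteq> U \<longrightarrow>
              uniform_limit K (\<lambda>k z. to_sphere (s (r k) z)) g sequentially)))"

definition fatou_set :: "(complex \<Rightarrow> complex) \<Rightarrow> complex set" where
  "fatou_set f =
     {z \<in> punctured_plane. \<exists>U. open U \<and> z \<in> U \<and> U \<subseteq> punctured_plane \<and>
        normal_family_on U {f ^^ n | n. n \<ge> 1}}"

definition julia_set :: "(complex \<Rightarrow> complex) \<Rightarrow> complex set" where
  "julia_set f = punctured_plane - fatou_set f"


section \<open>Escaping and fast escaping sets\<close>

definition omega_limit_set :: "(complex \<Rightarrow> complex) \<Rightarrow> complex \<Rightarrow> (complex \<times> real) set" where
  "omega_limit_set f z = (\<Inter>n. closure {to_sphere ((f ^^ k) z) | k. k \<ge> n})"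

definition escaping_set :: "(complex \<Rightarrow> complex) \<Rightarrow> complex set" where
  "escaping_set f =
     {z \<in> punctured_plane. omega_limit_set f z \<subseteq> {to_sphere 0, sphere_infinity}}"

definition max_modulus :: "(complex \<Rightarrow> complex) \<Rightarrow> real \<Rightarrow> real" where
  "max_modulus f r = (SUP z\<in>sphere 0 r. cmod (f z))"

definition min_modulus :: "(complex \<Rightarrow> complex) \<Rightarrow> real \<Rightarrow> real" where
  "min_modulus f r = (INF z\<in>sphere 0 r. cmod (f z))"

datatype puncture = Zero | Infty

primrec escape_radius ::
  "(complex \<Rightarrow> complex) \<Rightarrow> real \<Rightarrow> (nat \<Rightarrow> puncture) \<Rightarrow> nat \<Rightarrow> real" where
  "escape_radius f R e 0 = (case e 0 of Infty \<Rightarrow> R | Zero \<Rightarrow> 1 / R)"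
| "escape_radius f R e (Suc n) =
     (case e (Suc n) of
        Infty \<Rightarrow> max_modulus f (escape_radius f R e n)
      | Zero \<Rightarrow> min_modulus f (escape_radius f R e n))"

text \<open>
  The initial radius \<open>R\<close> is kept as a parameter; the fast escaping set of \<open>f\<close> is
  \<open>fast_escaping_set f R\<close> for any sufficiently large \<open>R\<close>.
\<close>

definition fast_escaping_set :: "(complex \<Rightarrow> complex) \<Rightarrow> real \<Rightarrow> complex set" where
  "fast_escaping_set f R =
     {z \<in> punctured_plane. \<exists>l e. \<forall>n.
        (e n = Infty \<longrightarrow> cmod ((f ^^ (n + l)) z) \<ge> escape_radius f R e n) \<and>
        (e n = Zero \<longrightarrow> cmod ((f ^^ (n + l)) z) \<le> escape_radius f R e n)}"


section \<open>Spiders' webs in the punctured plane\<close>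

definition bounded_in_punctured_plane :: "complex set \<Rightarrow> bool" where
  "bounded_in_punctured_plane X \<longleftrightarrow>
     X \<subseteq> punctured_plane \<and> closure (to_sphere ` X) \<inter> {to_sphere 0, sphere_infinity} = {}"

definition doubly_connected_separating :: "complex set \<Rightarrow> bool" where
  "doubly_connected_separating G \<longleftrightarrow>
     (\<exists>A B. components (riemann_sphere - to_sphere ` G) = {A, B} \<and> A \<noteq> B \<and>
        to_sphere 0 \<in> A \<and> sphere_infinity \<in> B)"

definition punctured_spiders_web :: "complex set \<Rightarrow> bool" where
  "punctured_spiders_web E \<longleftrightarrow>
     E \<subseteq> punctured_plane \<and> connected E \<and>
     (\<exists>G :: nat \<Rightarrow> complex set.
        (\<forall>n. open (G n) \<and> connected (G n) \<and> G n \<noteq> {} \<and>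
             bounded_in_punctured_plane (G n) \<and> doubly_connected_separating (G n) \<and>
             G n \<subseteq> G (Suc n) \<and> frontier (G n) \<subseteq> E) \<and>
        (\<Union>n. G n) = punctured_plane)"

definition separates_point_from ::
  "complex set \<Rightarrow> complex \<Rightarrow> (complex \<times> real) set \<Rightarrow> bool" where
  "separates_point_from E z X \<longleftrightarrow>
     (\<exists>U. open U \<and> z \<in> U \<and> closure (to_sphere ` U) \<inter> X = {} \<and> frontier U \<subseteq> E)"

end

theory Submission
  imports Defs
begin

text \<open>
  If \<open>E\<close> separates a Julia point from the punctures by a bounded open set \<open>U\<close>, then, by Montel's
  theorem, finitely many images \<open>f\<^sup>k(U)\<close> cover any given annulus; filling in the component of their
  union around that annulus gives the required domains, whose boundaries lie in \<open>E\<close> by invariance.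
  Since \<open>f\<close> takes both large and small values on every boundary curve close to infinity, the image of
  such a curve links all earlier ones, so that all the boundaries lie in one connected subset \<open>E\<^sub>0\<close>
  of \<open>E\<close>. Were \<open>E\<close> disconnected, there would be a bounded domain \<open>D\<close> meeting \<open>E\<close> with
  \<open>\<partial>D\<close> disjoint from \<open>E\<close>, all of whose images avoid \<open>E\<^sub>0\<close>. For the Julia set this contradicts the
  blow-up property; for the escaping sets \<open>f\<^sup>k(D)\<close> is squeezed to the punctures
  along with an orbit in \<open>E\<close>, which forces a point of \<open>\<partial>D\<close> into \<open>E\<close> (by the maximum principle in the
  fast escaping case). Conversely a web needs a Julia point to separate: if there were none, the escaping
  set would be open and closed in the punctured plane by Hurwitz's theorem, yet \<open>f\<close> has a fixed point.
\<close>

section \<open>Annuli and the Riemann sphere\<close>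

text \<open>The set \<open>U\<close> need not surround \<open>0\<close>; rings around
  \<open>0\<close> appear only once its images are merged. The main obstacle is the connectedness of
  \<open>E\<close>, since a priori nothing ties \<open>E\<close> to the boundaries of these rings.
  Each ring has two connected boundary pieces because the complementary components of a plane domain
  have connected frontiers; different pieces can be joined only through the dynamics. That
  \<open>f\<close> is both large and small on curves far out comes from the maximum principle for
  f(z)/z and for 1/(z f(z)): a bound of order z on curves enclosing arbitrarily large discs would
  spread to a neighbourhood of infinity and leave at most a pole there. The squeezing of f^k(D)
  along one orbit is purely topological: the image is connected and crosses no ring boundary, so it
  lies on the same side of each ring as the orbit. For fast escape this fixes the puncture that each
  image approaches, and one frontier point must then be found that respects all the levels of that
  orbit at once.\<close>

text \<open>The annulus is symmetric under inversion, so one radius measures the distance from both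
  punctures.\<close>

definition closed_annulus :: "real \<Rightarrow> complex set" where
  "closed_annulus r = {z. 1 / r \<le> cmod z \<and> cmod z \<le> r}"

lemma closed_annulus_mono: "0 < r \<Longrightarrow> r \<le> s \<Longrightarrow> closed_annulus r \<subseteq> closed_annulus s"
  unfolding closed_annulus_def by (auto intro: order_trans[of "1/s" "1/r"] simp: frac_le)

lemma closed_annulus_nonzero: "0 < r \<Longrightarrow> z \<in> closed_annulus r \<Longrightarrow> z \<noteq> 0"
  unfolding closed_annulus_def by auto

lemma closed_annulus_Int: "closed_annulus r = cball 0 r \<inter> - ball 0 (1 / r)"
  by (auto simp: closed_annulus_def)

lemma compact_closed_annulus: "compact (closed_annulus r)"
  unfolding closed_annulus_Int by (intro compact_Int_closed) auto

lemma connected_closed_annulus: "connected (closed_annulus r)"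
  using connected_annulus(4)[where a = "0::complex" and ?r1.0 = "1/r" and ?r2.0 = r]
  by (simp add: closed_annulus_def)

lemma closed_annulus_exhausts:
  assumes "z \<noteq> 0" obtains r where "r > 1" "z \<in> closed_annulus r"
proof
  let ?r = "1 + cmod z + 1 / cmod z"
  show "?r > 1" using assms by (simp add: add_pos_pos)
  have "1 / ?r \<le> 1 / (1 / cmod z)"
    using assms by (intro frac_le) auto
  then show "z \<in> closed_annulus ?r" using assms by (simp add: closed_annulus_def)
qed

lemma compact_subset_closed_annulus:
  assumes "compact X" "0 \<notin> X" obtains r where "r > 1" "X \<subseteq> closed_annulus r"
proof -
  obtain d where d: "d > 0" "\<And>z. z \<in> X \<Longrightarrow> d \<le> cmod z"
    using separate_point_closed[of X 0] assms compact_imp_closed by auto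
  obtain b where b: "\<And>z. z \<in> X \<Longrightarrow> cmod z \<le> b"
    using compact_imp_bounded[OF assms(1)] bounded_iff by blast
  let ?r = "2 + \<bar>b\<bar> + 1 / d"
  show thesis
  proof
    show "?r > 1" using d by (simp add: add_pos_pos add_pos_nonneg)
    have "1 / ?r \<le> 1 / (1 / d)"
      using d by (intro frac_le) auto
    then have "1 / ?r \<le> d" by simp
    moreover have "b \<le> ?r" using divide_pos_pos[OF zero_less_one d(1)] by linarith
    ultimately show "X \<subseteq> closed_annulus ?r" using d b unfolding closed_annulus_def by force
  qed
qed

section \<open>Stereographic projection and compactness in the punctured plane\<close>

lemma continuous_on_to_sphere [continuous_intros]:
  "continuous_on S g \<Longrightarrow> continuous_on S (\<lambda>x. to_sphere (g x))"
  using continuous_on_compose2[OF homeomorphism_cont1[OF homeomorphism_to_sphere]] by blast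

lemma from_sphere_to_sphere: "(\<lambda>(w, t). w /\<^sub>R (1 - t)) (to_sphere z) = z"
  by (rule homeomorphism_apply1[OF homeomorphism_to_sphere UNIV_I])

lemma inj_to_sphere: "inj to_sphere"
proof (rule injI)
  fix x y assume "to_sphere x = to_sphere y"
  then show "x = y"
    by (metis from_sphere_to_sphere)
qed

lemma range_to_sphere: "range to_sphere = riemann_sphere - {sphere_infinity}"
  by (rule homeomorphism_image1[OF homeomorphism_to_sphere])

lemma to_sphere_neq_infinity: "to_sphere z \<noteq> sphere_infinity"
proof -
  have "to_sphere z \<in> range to_sphere" by (rule rangeI)
  then show ?thesis unfolding range_to_sphere by (simp only: Diff_iff insert_iff) simp
qed

lemma punctures_notin_annulus:
  assumes "0 < r"
  shows "to_sphere 0 \<notin> to_sphere ` closed_annulus r" "sphere_infinity \<notin> to_sphere ` closed_annulus r"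
proof -
  show "to_sphere 0 \<notin> to_sphere ` closed_annulus r"
    using closed_annulus_nonzero[OF assms] inj_image_mem_iff[OF inj_to_sphere] by blast
  show "sphere_infinity \<notin> to_sphere ` closed_annulus r"
    using to_sphere_neq_infinity by (metis imageE)
qed

lemma closed_riemann_sphere: "closed riemann_sphere"
  by (simp add: riemann_sphere_def)

text \<open>The sphere is compact, so a chordal closure missing both punctures projects back to a
  compact subset of the punctured plane. From here on boundedness is handled with annuli
  only.\<close>

lemma bounded_in_punctured_plane_iff:
  "bounded_in_punctured_plane X \<longleftrightarrow> (\<exists>r>1. X \<subseteq> closed_annulus r)"
proof
  assume b: "bounded_in_punctured_plane X"
  let ?C = "closure (to_sphere ` X)" and ?g = "\<lambda>(w::complex, t). w /\<^sub>R (1 - t)"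
  have C: "?C \<subseteq> riemann_sphere"
    using range_to_sphere closed_riemann_sphere by (intro closure_minimal) auto
  then have cC: "compact ?C"
    using compact_sphere[of 0 1] closed_closure unfolding riemann_sphere_def
    by (metis Int_absorb1 compact_Int_closed)
  have C': "?C \<subseteq> riemann_sphere - {sphere_infinity}" "to_sphere 0 \<notin> ?C"
    using b C unfolding bounded_in_punctured_plane_def by auto
  have "compact (?g ` ?C)"
    using homeomorphism_cont2[OF homeomorphism_to_sphere] C' cC
    by (meson compact_continuous_image continuous_on_subset)
  moreover have "0 \<notin> ?g ` ?C"
  proof
    assume "0 \<in> ?g ` ?C"
    then obtain p where p: "p \<in> ?C" "?g p = 0" by (metis (no_types, lifting) imageE)
    then have "to_sphere (?g p) = p"
      using homeomorphism_apply2[OF homeomorphism_to_sphere] C' by blast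
    then show False using p C'(2) by simp
  qed
  ultimately obtain r where r: "r > 1" "?g ` ?C \<subseteq> closed_annulus r"
    using compact_subset_closed_annulus by metis
  have "x \<in> ?g ` ?C" if "x \<in> X" for x
    using closure_subset[of "to_sphere ` X"] that from_sphere_to_sphere[of x]
    by (metis (no_types, lifting) image_eqI subsetD)
  then show "\<exists>r>1. X \<subseteq> closed_annulus r" using r by blast
next
  assume "\<exists>r>1. X \<subseteq> closed_annulus r"
  then obtain r where r: "r > 1" "X \<subseteq> closed_annulus r" by blast
  have "compact (to_sphere ` closed_annulus r)"
    by (intro compact_continuous_image continuous_intros compact_closed_annulus)
  then have "closure (to_sphere ` X) \<subseteq> to_sphere ` closed_annulus r"
    using r by (intro closure_minimal) (auto intro: compact_imp_closed)
  moreover note punctures_notin_annulus[of r]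
  ultimately show "bounded_in_punctured_plane X"
    unfolding bounded_in_punctured_plane_def
    using r closed_annulus_nonzero[of r] by auto
qed

text \<open>Infinitely many visits to one annulus leave a limit point there, by nested compact sets;
  conversely a limit point off the punctures has an annular neighbourhood that is visited again and
  again.\<close>

lemma escaping_sequence_iff:
  fixes x :: "nat \<Rightarrow> complex"
  shows "(\<Inter>n. closure {to_sphere (x k) |k. k \<ge> n}) \<subseteq> {to_sphere 0, sphere_infinity} \<longleftrightarrow>
     (\<forall>r>1. \<forall>\<^sub>F k in sequentially. x k \<notin> closed_annulus r)"
    (is "?W \<subseteq> _ \<longleftrightarrow> ?R")
proof
  assume W: "?W \<subseteq> {to_sphere 0, sphere_infinity}"
  show ?R
  proof (intro allI impI, rule ccontr)
    fix r :: real assume "r > 1" and "\<not> (\<forall>\<^sub>F k in sequentially. x k \<notin> closed_annulus r)"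
    then have freq: "\<exists>k\<ge>n. x k \<in> closed_annulus r" for n
      by (auto simp: eventually_sequentially)
    let ?A = "to_sphere ` closed_annulus r"
    have A: "compact ?A"
      by (intro compact_continuous_image continuous_intros compact_closed_annulus)
    let ?C = "\<lambda>n. ?A \<inter> closure {to_sphere (x k) |k. k \<ge> n}"
    have "\<Inter> (range ?C) \<noteq> {}"
    proof (rule compact_nest)
      show "compact (?C n)" for n using A by blast
      show "?C n \<noteq> {}" for n
      proof -
        obtain k where k: "k \<ge> n" "x k \<in> closed_annulus r" using freq by blast
        then have "to_sphere (x k) \<in> {to_sphere (x k) |k. k \<ge> n}" by blast
        then have "to_sphere (x k) \<in> ?C n"
          using k closure_subset by (metis (no_types, lifting) IntI image_eqI subsetD)
        then show ?thesis by blast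
      qed
      show "?C n \<subseteq> ?C m" if "m \<le> n" for m n
        using that by (intro Int_mono closure_mono) auto
    qed
    then obtain p where p: "p \<in> ?W" "p \<in> ?A" by auto
    moreover have "to_sphere 0 \<notin> ?A" "sphere_infinity \<notin> ?A"
      using punctures_notin_annulus[of r] \<open>r > 1\<close> by auto
    moreover have "p = to_sphere 0 \<or> p = sphere_infinity" using subsetD[OF W p(1)] by simp
    ultimately show False by metis
  qed
next
  assume R: ?R
  show "?W \<subseteq> {to_sphere 0, sphere_infinity}"
  proof (rule subsetI, rule ccontr)
    fix p assume p: "p \<in> ?W" and np: "p \<notin> {to_sphere 0, sphere_infinity}"
    have "closure {to_sphere (x k) |k. k \<ge> 0} \<subseteq> riemann_sphere"
      using range_to_sphere closed_riemann_sphere by (intro closure_minimal) auto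
    moreover have pn: "\<And>n. p \<in> closure {to_sphere (x k) |k. k \<ge> n}"
      using p by (simp only: INT_iff UNIV_I)
    ultimately have "p \<in> riemann_sphere" by (meson subsetD)
    then have "p \<in> range to_sphere" unfolding range_to_sphere using np by simp
    then obtain w where w: "p = to_sphere w" by (rule rangeE)
    have "w \<noteq> 0" using np w by auto
    obtain r where r: "r > 1" "w \<in> closed_annulus r" using closed_annulus_exhausts \<open>w \<noteq> 0\<close> by blast
    \<comment> \<open>The point \<open>w\<close> may lie on the boundary of its closed annulus;
      increasing the radius by 1 makes it interior.\<close>
    have wi: "w \<in> {z. 1 / (r+1) < cmod z \<and> cmod z < r + 1}"
      using r frac_less2[of 1 1 r "r+1"] by (auto simp: closed_annulus_def)
    let ?O = "{z. 1 / (r+1) < cmod z \<and> cmod z < r + 1}"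
    have "open ?O" by (intro open_Collect_conj open_Collect_less continuous_intros)
    then have "openin (top_of_set (riemann_sphere - {sphere_infinity})) (to_sphere ` ?O)"
      using homeomorphism_imp_open_map[OF homeomorphism_to_sphere] by simp
    then obtain T where T: "open T" "to_sphere ` ?O = (riemann_sphere - {sphere_infinity}) \<inter> T"
      unfolding openin_open by blast
    obtain n where n: "\<And>k. k \<ge> n \<Longrightarrow> x k \<notin> closed_annulus (r+1)"
      using R[rule_format, of "r + 1"] r by (auto simp: eventually_sequentially)
    have "p \<in> to_sphere ` ?O" using w wi by (rule image_eqI)
    then have pT: "p \<in> T" unfolding T(2) by (rule IntD2)
    have "{to_sphere (x k) |k. k \<ge> n} \<inter> T \<noteq> {}"
      using pn[of n] T(1) pT by (meson IntI closure_iff_nhds_not_empty inf_commute order_refl)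
    then obtain k where "k \<ge> n" "to_sphere (x k) \<in> T" by blast
    then have "to_sphere (x k) \<in> to_sphere ` ?O"
      unfolding T(2) range_to_sphere[symmetric] by (intro IntI rangeI)
    then have "x k \<in> ?O" by (simp only: inj_image_mem_iff[OF inj_to_sphere])
    then show False using n[OF \<open>k \<ge> n\<close>] by (auto simp: closed_annulus_def)
  qed
qed


section \<open>Growth near an essential singularity\<close>

lemma tsmD:
  assumes "transcendental_self_map f"
  shows tsm_holomorphic: "f holomorphic_on punctured_plane"
    and tsm_nonzero: "\<And>z. z \<noteq> 0 \<Longrightarrow> f z \<noteq> 0"
  using assms unfolding transcendental_self_map_def by auto

lemma holomorphic_flip:
  assumes "f holomorphic_on punctured_plane"
  shows "(\<lambda>z. f (1 / z)) holomorphic_on punctured_plane"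
proof -
  have "(\<lambda>z::complex. 1 / z) holomorphic_on punctured_plane" by (intro holomorphic_intros) auto
  from holomorphic_on_compose_gen[OF this assms] show ?thesis unfolding o_def by fastforce
qed

lemma isolated_singularity_at_0:
  assumes "f holomorphic_on punctured_plane"
  shows "isolated_singularity_at f 0"
  using isolated_singularity_at_holomorphic[of f UNIV 0] assms by (simp add: Compl_eq_Diff_UNIV)

lemma essential_singularity_inverse:
  assumes "f holomorphic_on punctured_plane" "\<And>z. z \<noteq> 0 \<Longrightarrow> f z \<noteq> 0"
    and "essential_singularity_at f 0"
  shows "essential_singularity_at (\<lambda>z. 1 / f z) 0"
proof -
  have h: "(\<lambda>z. 1 / f z) holomorphic_on punctured_plane"
    using assms by (intro holomorphic_intros) auto
  have "not_essential (\<lambda>z. inverse (1 / f z)) 0" if "not_essential (\<lambda>z. 1 / f z) 0"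
    using that isolated_singularity_at_0[OF h] by (rule not_essential_inverse)
  then show ?thesis
    using assms(3) isolated_singularity_at_0[OF h] by (auto simp: essential_singularity_at_def)
qed

text \<open>Exchanges large and small values, so that statements about values near \<open>0\<close>
  follow from those about values near infinity.\<close>

lemma tsm_inverse:
  assumes "transcendental_self_map f"
  shows "transcendental_self_map (\<lambda>z. 1 / f z)"
proof -
  have h: "f holomorphic_on punctured_plane" and nz: "\<And>z. z \<noteq> 0 \<Longrightarrow> f z \<noteq> 0"
    using tsmD[OF assms] by auto
  have e: "essential_singularity_at f 0" "essential_singularity_at (\<lambda>z. f (1 / z)) 0"
    using assms unfolding transcendental_self_map_def by blast+
  have "essential_singularity_at (\<lambda>z. 1 / f z) 0"
    using h nz e(1) by (rule essential_singularity_inverse)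
  moreover have "essential_singularity_at (\<lambda>z. 1 / f (1 / z)) 0"
    using holomorphic_flip[OF h] _ e(2) by (rule essential_singularity_inverse) (simp add: nz)
  moreover have "(\<lambda>z. 1 / f z) holomorphic_on punctured_plane"
    by (rule holomorphic_on_divide[OF holomorphic_on_const h]) (simp add: nz)
  moreover have "(\<lambda>z. 1 / f z) ` punctured_plane \<subseteq> punctured_plane"
    by (rule image_subsetI) (simp add: nz)
  ultimately show ?thesis unfolding transcendental_self_map_def by blast
qed

lemma tsm_flip:
  assumes "transcendental_self_map f"
  shows "transcendental_self_map (\<lambda>z. f (1 / z))"
  using assms holomorphic_flip[of f] tsm_nonzero[OF assms] by (auto simp: transcendental_self_map_def)

text \<open>Growth of order \<open>O(z)\<close> at infinity would turn the essential singularity into a pole.\<close>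

lemma tsm_superlinear:
  assumes "transcendental_self_map f"
  shows "\<exists>z. cmod z > 1 \<and> cmod (f z) > C * cmod z"
proof (rule ccontr)
  assume "\<not> ?thesis"
  then have bd: "\<And>z. cmod z > 1 \<Longrightarrow> cmod (f z) \<le> C * cmod z" by (meson not_le)
  \<comment> \<open>The assumed bound makes \<open>g\<close> bounded near \<open>0\<close>, so its
    singularity is removable; dividing by \<open>w\<close> again leaves at most a pole of
    \<open>f (1 / w)\<close>.\<close>
  define g where "g w = w * f (1 / w)" for w
  have hf: "(\<lambda>w. f (1 / w)) holomorphic_on punctured_plane"
    using holomorphic_flip tsm_holomorphic assms by blast
  have hg: "g holomorphic_on UNIV - {0}"
    unfolding g_def using hf by (intro holomorphic_intros) (simp add: Compl_eq_Diff_UNIV)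
  have "\<forall>\<^sub>F w in at 0. w \<in> ball 0 1 - {0}"
    by (rule eventually_at_in_open) auto
  then have "\<forall>\<^sub>F w in at 0. cmod (g w) \<le> C"
  proof eventually_elim
    case (elim w)
    then have "cmod (f (1 / w)) \<le> C * cmod (1 / w)" by (intro bd) (auto simp: norm_divide)
    then have "cmod w * cmod (f (1 / w)) \<le> cmod w * (C * cmod (1 / w))"
      by (intro mult_left_mono) auto
    then show ?case using elim by (simp add: g_def norm_mult norm_divide)
  qed
  then obtain h where h: "h holomorphic_on UNIV" "\<And>w. w \<noteq> 0 \<Longrightarrow> h w = g w"
    using holomorphic_on_extend_bounded[OF hg, of] by auto
  have "isCont h 0"
    using h(1) holomorphic_on_imp_continuous_on continuous_on_eq_continuous_at open_UNIV by blast
  then have "h \<midarrow>0\<rightarrow> h 0" by (simp add: isCont_def)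
  moreover have "\<forall>\<^sub>F w in at 0. h w = g w" using h(2) by (auto simp: eventually_at_filter)
  ultimately have "g \<midarrow>0\<rightarrow> h 0" using tendsto_cong by blast
  then have "not_essential g 0" by (auto simp: not_essential_def)
  moreover have "isolated_singularity_at g 0"
    using hg isolated_singularity_at_0 by (simp add: Compl_eq_Diff_UNIV)
  moreover have "not_essential (\<lambda>w. w) 0" "isolated_singularity_at (\<lambda>w. w) 0"
    using isolated_singularity_at_0[of "\<lambda>w. w"] by (auto simp: not_essential_def intro: tendsto_ident_at)
  ultimately have "not_essential (\<lambda>w. g w / w) 0" by (intro not_essential_divide)
  moreover have "\<forall>\<^sub>F w in at 0. g w / w = f (1 / w)" by (auto simp: eventually_at_filter g_def)
  ultimately have "not_essential (\<lambda>w. f (1 / w)) 0" using not_essential_cong[of "\<lambda>w. g w / w" "\<lambda>w. f (1 / w)" 0 0] by simp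
  then show False using assms by (simp add: transcendental_self_map_def essential_singularity_at_def)
qed

text \<open>The maximum principle for f(z)/z carries a linear bound from the frontier of
  \<open>H\<close> to \<open>z\<close>. As \<open>C\<close> is the same for all \<open>z\<close>,
  this contradicts superlinear growth.\<close>

lemma tsm_not_bounded_on_frontiers:
  assumes f: "transcendental_self_map f"
    and H: "\<And>z. cmod z > 1 \<Longrightarrow> \<exists>H. open H \<and> bounded H \<and> z \<in> H \<and>
        (\<forall>w \<in> frontier H. cmod w \<ge> 1 \<longrightarrow> cmod (f w) \<le> C * cmod w)"
  shows False
proof -
  have hol: "f holomorphic_on punctured_plane" using f by (rule tsm_holomorphic)
  then have cf: "continuous_on punctured_plane f" by (rule holomorphic_on_imp_continuous_on)
  have "compact (f ` sphere 0 1)"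
    by (intro compact_continuous_image continuous_on_subset[OF cf]) auto
  then obtain M where M: "\<And>z. cmod z = 1 \<Longrightarrow> cmod (f z) \<le> M"
    using compact_imp_bounded[of "f ` sphere 0 1"] unfolding bounded_iff by (metis imageI mem_sphere_0)
  have "cmod (f z) \<le> max C M * cmod z" if z: "cmod z > 1" for z
  proof -
    obtain H where H: "open H" "bounded H" "z \<in> H"
      "\<And>w. w \<in> frontier H \<Longrightarrow> cmod w \<ge> 1 \<Longrightarrow> cmod (f w) \<le> C * cmod w"
      using H[OF z] by blast
    \<comment> \<open>\<open>H\<close> may contain \<open>0\<close>, where f(z)/z is singular.
      Removing the unit disc adds at most part of the unit circle to the frontier, and there
      \<open>M\<close> bounds the quotient.\<close>
    let ?S = "H - cball 0 1"
    have cl: "closure ?S \<subseteq> {w. cmod w \<ge> 1}"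
      by (intro closure_minimal closed_Collect_le continuous_intros) auto
    have "cmod (f z / z) \<le> max C M"
    proof (rule maximum_modulus_frontier[where S = ?S and f = "\<lambda>z. f z / z" and \<xi> = z])
      have "?S \<subseteq> punctured_plane" by auto
      then show "(\<lambda>z. f z / z) holomorphic_on interior ?S"
        using interior_subset[of ?S] by (intro holomorphic_intros holomorphic_on_subset[OF hol]) auto
      show "continuous_on (closure ?S) (\<lambda>z. f z / z)"
        using cl by (intro continuous_intros continuous_on_subset[OF cf]) force+
      show "bounded ?S" using H(2) by (rule bounded_diff)
      show "z \<in> ?S" using H(3) z by simp
      fix w assume w: "w \<in> frontier ?S"
      have "frontier ?S \<subseteq> frontier H \<union> sphere 0 1"
        using frontier_Int_subset[of H "- cball 0 1"] by (auto simp: Diff_eq)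
      moreover have w1: "cmod w \<ge> 1" using w cl by (auto simp: frontier_def)
      ultimately consider "w \<in> frontier H" | "cmod w = 1" using w by auto
      then have "cmod (f w) \<le> max C M * cmod w"
      proof cases
        case 1
        then have "cmod (f w) \<le> C * cmod w" using H(4) w1 by blast
        also have "\<dots> \<le> max C M * cmod w" by (intro mult_right_mono) auto
        finally show ?thesis .
      next
        case 2
        then show ?thesis using M[of w] by simp
      qed
      then show "cmod (f w / w) \<le> max C M"
        using w1 by (subst norm_divide, subst pos_divide_le_eq) auto
    qed
    then have "cmod (f z) / cmod z \<le> max C M" by (simp only: norm_divide)
    then show ?thesis using z by (subst (asm) pos_divide_le_eq) auto
  qed
  then show False using tsm_superlinear[OF f, of "max C M"] by force
qed

section \<open>Growth and monotonicity of the maximum modulus\<close>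

lemma cmod_le_max_modulus:
  assumes "transcendental_self_map f" "z \<noteq> 0"
  shows "cmod (f z) \<le> max_modulus f (cmod z)"
    and max_modulus_attained:
      "r > 0 \<Longrightarrow> \<exists>w. cmod w = r \<and> cmod (f w) = max_modulus f r"
proof -
  have cf: "continuous_on punctured_plane f"
    using assms tsm_holomorphic holomorphic_on_imp_continuous_on by blast
  have co: "compact ((\<lambda>z. cmod (f z)) ` sphere 0 r)" if "r > 0" for r
    using that by (intro compact_continuous_image continuous_intros continuous_on_subset[OF cf]) auto
  show "cmod (f z) \<le> max_modulus f (cmod z)"
    unfolding max_modulus_def using assms
    by (intro cSUP_upper bounded_imp_bdd_above compact_imp_bounded co) auto
  show "\<exists>w. cmod w = r \<and> cmod (f w) = max_modulus f r" if r: "r > 0"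
  proof -
    have "Sup ((\<lambda>z. cmod (f z)) ` sphere 0 r) \<in> (\<lambda>z. cmod (f z)) ` sphere 0 r"
      using co[OF r] r
      by (intro closed_contains_Sup compact_imp_closed bounded_imp_bdd_above compact_imp_bounded)
        (auto simp: not_less)
    then show ?thesis unfolding max_modulus_def by (auto simp: image_iff)
  qed
qed

text \<open>Radii violating the inequality would be unbounded, and the discs of those radii would
  satisfy \<open>tsm_not_bounded_on_frontiers\<close>.\<close>

lemma eventually_max_modulus_growth:
  assumes f: "transcendental_self_map f"
  shows "\<forall>\<^sub>F r in at_top. C * r < max_modulus f r"
proof (rule ccontr)
  assume "\<not> ?thesis"
  then have fr: "\<exists>r\<ge>s. max_modulus f r \<le> C * r" for s
    by (auto simp: eventually_at_top_linorder not_less)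
  show False
  proof (rule tsm_not_bounded_on_frontiers[OF f])
    fix z :: complex assume "cmod z > 1"
    obtain r where r: "r \<ge> cmod z + 1" "max_modulus f r \<le> C * r" using fr by blast
    have "cmod (f w) \<le> C * cmod w" if "cmod w = r" for w
    proof -
      have "w \<noteq> 0" using that r \<open>cmod z > 1\<close> by auto
      from cmod_le_max_modulus(1)[OF f this] show ?thesis using that r by simp
    qed
    then show "\<exists>H. open H \<and> bounded H \<and> z \<in> H \<and>
        (\<forall>w \<in> frontier H. cmod w \<ge> 1 \<longrightarrow> cmod (f w) \<le> C * cmod w)"
      using r \<open>cmod z > 1\<close> by (intro exI[of _ "ball 0 r"]) auto
  qed
qed

text \<open>Because of the singularity at \<open>0\<close>, monotonicity can hold only for large
  radii. There the modulus on a fixed inner circle is already exceeded, so a failure of monotonicity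
  would produce an interior maximum on an annulus and force \<open>f\<close> to be constant on
  it.\<close>

lemma max_modulus_eventually_strict_mono:
  assumes f: "transcendental_self_map f"
  shows "\<exists>R>1. \<forall>r s. R \<le> r \<longrightarrow> r < s \<longrightarrow> max_modulus f r < max_modulus f s"
proof -
  \<comment> \<open>1/2 is the inner radius of the annulus below and 1 is a test point inside it.
    With this slope, and since the radius is at least 1, growth makes the maximum modulus exceed its
    values at both.\<close>
  let ?m = "\<bar>max_modulus f 1\<bar> + \<bar>max_modulus f (1/2)\<bar>"
  obtain R where R: "\<And>r. r \<ge> R \<Longrightarrow> ?m * r < max_modulus f r"
    using eventually_max_modulus_growth[OF f, of "?m"]
    by (auto simp: eventually_at_top_linorder)
  have hol: "f holomorphic_on punctured_plane" using f by (rule tsm_holomorphic)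
  then have cf: "continuous_on punctured_plane f" by (rule holomorphic_on_imp_continuous_on)
  have "max_modulus f r < max_modulus f s" if r: "max R 2 \<le> r" and s: "r < s" for r s
  proof (rule ccontr)
    assume "\<not> ?thesis"
    then have le: "max_modulus f s \<le> max_modulus f r" by simp
    have "?m * 1 \<le> ?m * r"
      using r by (intro mult_left_mono) auto
    then have m1: "max_modulus f 1 < max_modulus f r" "max_modulus f (1/2) < max_modulus f r"
      using R[of r] r by auto
    let ?S = "{z. 1/2 < cmod z \<and> cmod z < s}"
    have oS: "open ?S" by (intro open_Collect_conj open_Collect_less continuous_intros)
    have cS: "closure ?S \<subseteq> {z. 1/2 \<le> cmod z \<and> cmod z \<le> s}"
      by (intro closure_minimal closed_Collect_conj closed_Collect_le continuous_intros) auto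
    obtain a where a: "cmod a = r" "cmod (f a) = max_modulus f r"
      using max_modulus_attained[OF f, of 1 r] r by auto
    have bound: "cmod (f z) \<le> cmod (f a)" if "z \<in> ?S" for z
    proof (rule maximum_modulus_frontier[where S = ?S and f = f and \<xi> = z])
      have "?S \<subseteq> punctured_plane" by auto
      then show "f holomorphic_on interior ?S"
        using interior_subset[of ?S] by (intro holomorphic_on_subset[OF hol]) auto
      show "continuous_on (closure ?S) f"
        using cS by (intro continuous_on_subset[OF cf]) force
      show "bounded ?S" by (rule bounded_subset[of "ball 0 s"]) auto
      fix w assume "w \<in> frontier ?S"
      then have "w \<in> closure ?S" "w \<notin> ?S" using oS by (auto simp: frontier_def interior_open)
      then consider "cmod w = 1/2" | "cmod w = s" using cS by force
      then show "cmod (f w) \<le> cmod (f a)"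
        using cmod_le_max_modulus(1)[OF f, of w] a m1 le r s by cases force+
    qed fact
    have "f constant_on ?S"
    proof (rule maximum_modulus_principle[OF _ oS _ oS order_refl, of f a])
      show "f holomorphic_on ?S" by (rule holomorphic_on_subset[OF hol]) auto
      show "connected ?S" using connected_annulus(1)[where a = "0::complex" and ?r1.0 = "1/2" and ?r2.0 = s] by simp
      show "a \<in> ?S" using a r s by simp
    qed (rule bound)
    then obtain c where c: "\<And>z. z \<in> ?S \<Longrightarrow> f z = c" by (auto simp: constant_on_def)
    have "f 1 = f a" using c[of a] c[of 1] a r s by simp
    then show False using cmod_le_max_modulus(1)[OF f, of 1] a m1 by auto
  qed
  then show ?thesis by (intro exI[of _ "max R 2"]) auto
qed


section \<open>Normality, blow-up and invariance\<close>

lemma open_punctured_plane: "open punctured_plane"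
  by (simp add: open_Compl)

lemma connected_punctured_plane: "connected punctured_plane"
  using connected_punctured_universe[of "0::complex"] by simp

lemma frontier_image_subset:
  fixes g :: "'a::metric_space \<Rightarrow> 'b::metric_space"
  assumes "open (g ` U)" "compact (closure U)" "continuous_on (closure U) g"
  shows "frontier (g ` U) \<subseteq> g ` frontier U"
proof
  fix w assume w: "w \<in> frontier (g ` U)"
  have "compact (g ` closure U)" using assms compact_continuous_image by blast
  then have "closure (g ` U) \<subseteq> g ` closure U"
    using closure_subset[of U] by (intro closure_minimal compact_imp_closed) blast+
  then obtain z where z: "z \<in> closure U" "w = g z" using w by (auto simp: frontier_def)
  have "w \<notin> g ` U" using w assms(1) by (simp add: frontier_def interior_open)
  then have "z \<notin> interior U" using z interior_subset by blast
  then show "w \<in> g ` frontier U" using z by (auto simp: frontier_def)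
qed

text \<open>Inversion acts on the sphere as a half-turn about the real axis. It is the restriction
  of a linear isometry, so it preserves uniform limits in the chordal metric.\<close>

lemma to_sphere_inverse:
  assumes "u \<noteq> 0"
  shows "to_sphere (1 / u) = (cnj (fst (to_sphere u)), - snd (to_sphere u))"
proof -
  define m where "m = (cmod u)\<^sup>2"
  have m: "m > 0" using assms by (simp add: m_def)
  have "1 / u = (1 / m) *\<^sub>R cnj u"
    using complex_div_cnj[of 1 u] by (simp add: m_def scaleR_conv_of_real)
  moreover have "(cmod (1 / u))\<^sup>2 = 1 / m" by (simp add: m_def norm_divide power_divide)
  moreover have "2 / (1 + 1 / m) * (1 / m) = 2 / (1 + m)" "(1 / m - 1) / (1 + 1 / m) = - ((m - 1) / (1 + m))"
  proof -
    have e: "1 + 1 / m = (1 + m) / m" "1 / m - 1 = (1 - m) / m" using m by (simp_all add: field_simps)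
    show "2 / (1 + 1 / m) * (1 / m) = 2 / (1 + m)" unfolding e using m by simp
    show "(1 / m - 1) / (1 + 1 / m) = - ((m - 1) / (1 + m))"
      unfolding e using m by (simp add: minus_divide_left)
  qed
  ultimately show ?thesis unfolding to_sphere_def m_def[symmetric] by (simp add: scaleR_conv_of_real[symmetric])
qed

lemma uniform_limit_to_sphere:
  assumes "uniform_limit K h g sequentially" "\<And>n z. z \<in> K \<Longrightarrow> cmod (h n z) \<le> B"
  shows "uniform_limit K (\<lambda>n z. to_sphere (h n z)) (\<lambda>z. to_sphere (g z)) sequentially"
proof (rule uniform_limit_compose_uniformly_continuous_on[OF assms(1)])
  show "uniformly_continuous_on (cball 0 B) to_sphere"
    using continuous_on_to_sphere[OF continuous_on_id] by (intro compact_uniformly_continuous) auto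
qed (use assms(2) in auto)

text \<open>Division by \<open>w\<close> turns the omitted values into 0 and 1. The bound at
  \<open>a\<close> then gives local boundedness by Schottky's theorem (\<open>GPicard3\<close>), and
  the locally bounded form of Montel's theorem applies.\<close>

lemma normal_subsequence_omitting_le:
  fixes s :: "nat \<Rightarrow> complex \<Rightarrow> complex"
  assumes S: "open S" "connected S" "a \<in> S" and w: "w \<noteq> 0"
    and hol: "\<And>n. s n holomorphic_on S"
    and om: "\<And>n z. z \<in> S \<Longrightarrow> s n z \<noteq> 0 \<and> s n z \<noteq> w"
    and le: "\<And>n. cmod (s n a) \<le> cmod w"
  obtains r g where "strict_mono (r :: nat \<Rightarrow> nat)"
    "\<And>K. compact K \<Longrightarrow> K \<subseteq> S \<Longrightarrow> uniform_limit K (\<lambda>k z. to_sphere (s (r k) z)) g sequentially"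
proof -
  define h where "h n z = s n z / w" for n z
  have bd: "\<exists>B. \<forall>u\<in>range h. \<forall>z\<in>K. cmod (u z) \<le> B" if K: "compact K" "K \<subseteq> S" for K
  proof (rule GPicard3[OF S order_refl _ _ _ K, of "range h"])
    show "u holomorphic_on S" if u: "u \<in> range h" for u
    proof -
      obtain n where "u = h n" using u by blast
      moreover have "h n holomorphic_on S"
        unfolding h_def using w hol by (intro holomorphic_intros) auto
      ultimately show ?thesis by simp
    qed
    show "u z \<noteq> 0 \<and> u z \<noteq> 1" if "u \<in> range h" "z \<in> S" for u z
      using that om[of z] w by (auto simp: h_def)
    show "cmod (u a) \<le> 1" if "u \<in> range h" for u
      using that le w by (auto simp: h_def norm_divide divide_le_eq)
  qed blast
  obtain g r where r: "strict_mono (r :: nat \<Rightarrow> nat)"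
    and lim: "\<And>K. compact K \<Longrightarrow> K \<subseteq> S \<Longrightarrow> uniform_limit K (h \<circ> r) g sequentially"
  proof (rule Montel[OF S(1), of "range h" h])
    show "u holomorphic_on S" if u: "u \<in> range h" for u
    proof -
      obtain n where "u = h n" using u by blast
      moreover have "h n holomorphic_on S"
        unfolding h_def using w hol by (intro holomorphic_intros) auto
      ultimately show ?thesis by simp
    qed
  qed (use bd in auto)
  show thesis
  proof (rule that[OF r])
    fix K assume K: "compact K" "K \<subseteq> S"
    obtain B where B: "\<And>n z. z \<in> K \<Longrightarrow> cmod (h n z) \<le> B" using bd[OF K] by blast
    have "uniform_limit K (\<lambda>k z. h (r k) z) g sequentially" using lim[OF K] by (simp add: o_def)
    then have u: "uniform_limit K (\<lambda>k z. w * h (r k) z) (\<lambda>z. w * g z) sequentially"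
      by (rule bounded_linear.uniform_limit[OF bounded_linear_mult_right])
    moreover have "w * h n z = s n z" for n z using w by (simp add: h_def)
    ultimately have "uniform_limit K (\<lambda>k z. s (r k) z) (\<lambda>z. w * g z) sequentially" by simp
    moreover have "cmod (s (r n) z) \<le> cmod w * B" if "z \<in> K" for n z
    proof -
      have "cmod (s (r n) z) = cmod w * cmod (h (r n) z)" using w by (simp add: h_def norm_divide)
      also have "\<dots> \<le> cmod w * B" using B[OF that] by (intro mult_left_mono) auto
      finally show ?thesis .
    qed
    ultimately show "uniform_limit K (\<lambda>k z. to_sphere (s (r k) z)) (\<lambda>z. to_sphere (w * g z)) sequentially"
      by (rule uniform_limit_to_sphere)
  qed
qed

text \<open>Montel's theorem for the omitted values \<open>0\<close>, \<open>w\<close> and infinity.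
  Along a subsequence the values at \<open>a\<close> are all small or all large compared with
  \<open>w\<close>; the large case passes to reciprocals and is undone by the half-turn of the
  sphere.\<close>

lemma normal_family_on_omitting:
  assumes S: "open S" "connected S" "a \<in> S" and w: "w \<noteq> 0"
    and hol: "\<And>h. h \<in> F \<Longrightarrow> h holomorphic_on S"
    and om: "\<And>h z. h \<in> F \<Longrightarrow> z \<in> S \<Longrightarrow> h z \<noteq> 0 \<and> h z \<noteq> w"
  shows "normal_family_on S F"
  unfolding normal_family_on_def
proof (intro allI impI)
  fix s :: "nat \<Rightarrow> complex \<Rightarrow> complex" assume s: "range s \<subseteq> F"
  then have shol: "\<And>n. s n holomorphic_on S" and som: "\<And>n z. z \<in> S \<Longrightarrow> s n z \<noteq> 0 \<and> s n z \<noteq> w"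
    using hol om by blast+
  let ?A = "{n. cmod (s n a) \<le> cmod w}" and ?B = "{n. cmod w \<le> cmod (s n a)}"
  have "?A \<union> ?B = UNIV" by auto
  then have "infinite ?A \<or> infinite ?B" by (metis finite_Un infinite_UNIV_nat)
  then show "\<exists>(r :: nat \<Rightarrow> nat) g. strict_mono r \<and> (\<forall>K. compact K \<and> K \<subseteq> S \<longrightarrow>
      uniform_limit K (\<lambda>k z. to_sphere (s (r k) z)) g sequentially)"
  proof
    assume "infinite ?A"
    then obtain q :: "nat \<Rightarrow> nat" where q: "strict_mono q" "\<And>n. q n \<in> ?A"
      using infinite_enumerate by blast
    obtain r g where r: "strict_mono r"
      "\<And>K. compact K \<Longrightarrow> K \<subseteq> S \<Longrightarrow> uniform_limit K (\<lambda>k z. to_sphere (s (q (r k)) z)) g sequentially"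
      by (rule normal_subsequence_omitting_le[OF S w, of "\<lambda>n. s (q n)"]) (use shol som q in auto)
    show ?thesis
      using r strict_mono_o[OF q(1) r(1)] by (intro exI[of _ "q \<circ> r"] exI[of _ g]) auto
  next
    assume "infinite ?B"
    then obtain q :: "nat \<Rightarrow> nat" where q: "strict_mono q" "\<And>n. q n \<in> ?B"
      using infinite_enumerate by blast
    have w': "1 / w \<noteq> 0" using w by simp
    obtain r g where r: "strict_mono r"
      "\<And>K. compact K \<Longrightarrow> K \<subseteq> S \<Longrightarrow> uniform_limit K (\<lambda>k z. to_sphere (1 / s (q (r k)) z)) g sequentially"
    proof (rule normal_subsequence_omitting_le[OF S w', of "\<lambda>n z. 1 / s (q n) z"])
      show "(\<lambda>z. 1 / s (q n) z) holomorphic_on S" for n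
        using som by (intro holomorphic_on_divide holomorphic_on_const shol) blast
      show "1 / s (q n) z \<noteq> 0 \<and> 1 / s (q n) z \<noteq> 1 / w" if "z \<in> S" for n z
        using som[OF that] w by (auto simp: field_simps)
      show "cmod (1 / s (q n) a) \<le> cmod (1 / w)" for n
        using q(2)[of n] w som[OF S(3)] by (simp add: norm_divide frac_le)
    qed blast
    let ?g = "\<lambda>z. (cnj (fst (g z)), - snd (g z))"
    have "uniform_limit K (\<lambda>k z. to_sphere (s (q (r k)) z)) ?g sequentially"
      if K: "compact K" "K \<subseteq> S" for K
    proof -
      have "bounded_linear (\<lambda>p. (cnj (fst p), - snd p) :: complex \<times> real)"
        by (intro bounded_linear_Pair bounded_linear_minus bounded_linear_snd
            bounded_linear_compose[OF bounded_linear_cnj bounded_linear_fst])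
      from bounded_linear.uniform_limit[OF this r(2)[OF K]]
      have "uniform_limit K (\<lambda>k z. (cnj (fst (to_sphere (1 / s (q (r k)) z))),
          - snd (to_sphere (1 / s (q (r k)) z)))) ?g sequentially" .
      moreover have "(cnj (fst (to_sphere (1 / s (q (r k)) z))), - snd (to_sphere (1 / s (q (r k)) z)))
          = to_sphere (s (q (r k)) z)" if "z \<in> K" for k z
        using som[of z "q (r k)"] that K to_sphere_inverse[of "1 / s (q (r k)) z"] by auto
      ultimately show ?thesis
        by (subst (asm) uniform_limit_cong'[where g = "\<lambda>k z. to_sphere (s (q (r k)) z)" and i = ?g]) auto
    qed
    then show ?thesis
      using strict_mono_o[OF q(1) r(1)] by (intro exI[of _ "q \<circ> r"] exI[of _ ?g]) auto
  qed
qed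

locale punctured_dynamics =
  fixes f :: "complex \<Rightarrow> complex"
  assumes tsm: "transcendental_self_map f"
begin

lemma f_holomorphic: "f holomorphic_on punctured_plane" and f_nonzero: "z \<noteq> 0 \<Longrightarrow> f z \<noteq> 0"
  using tsmD[OF tsm] by auto

lemma iter_nonzero: "z \<noteq> 0 \<Longrightarrow> (f ^^ n) z \<noteq> 0"
  by (induction n) (auto simp: f_nonzero)

lemma iter_holomorphic: "(f ^^ n) holomorphic_on punctured_plane"
proof (induction n)
  case (Suc n)
  have "(f ^^ n) ` punctured_plane \<subseteq> punctured_plane"
    by (rule image_subsetI) (simp add: iter_nonzero)
  from holomorphic_on_compose_gen[OF Suc f_holomorphic this] show ?case by (simp add: o_def)
qed (simp add: id_def)

lemma iter_continuous: "continuous_on punctured_plane (f ^^ n)"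
  using iter_holomorphic holomorphic_on_imp_continuous_on by blast

lemma open_f_image:
  assumes "open U" "0 \<notin> U" shows "open (f ` U)"
proof (rule open_mapping_thm[OF f_holomorphic open_punctured_plane connected_punctured_plane assms(1)])
  show "U \<subseteq> punctured_plane" using assms by auto
  show "\<not> f constant_on punctured_plane"
  proof
    assume "f constant_on punctured_plane"
    then obtain c where c: "\<And>z. z \<noteq> 0 \<Longrightarrow> f z = c" by (auto simp: constant_on_def)
    obtain z where z: "cmod z > 1" "cmod (f z) > cmod c * cmod z"
      using tsm_superlinear[OF tsm] by blast
    have "cmod c * 1 \<le> cmod c * cmod z" using z by (intro mult_left_mono) auto
    moreover have "f z = c" using z by (intro c) auto
    ultimately show False using z by simp
  qed
qed

lemma open_iter_image:
  assumes "open U" "0 \<notin> U" shows "open ((f ^^ n) ` U)"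
proof (induction n)
  case (Suc n)
  have "0 \<notin> (f ^^ n) ` U" using assms(2) iter_nonzero by (metis imageE)
  from open_f_image[OF Suc this] show ?case by (simp add: image_comp)
qed (use assms in simp)

lemma frontier_iter_image:
  assumes "open U" "compact (closure U)" "0 \<notin> closure U"
  shows "frontier ((f ^^ n) ` U) \<subseteq> (f ^^ n) ` frontier U"
proof (rule frontier_image_subset[OF open_iter_image])
  show "0 \<notin> U" using assms closure_subset by blast
  show "continuous_on (closure U) (f ^^ n)"
    using assms by (intro continuous_on_subset[OF iter_continuous]) auto
qed (use assms in auto)

text \<open>All iterates omit \<open>0\<close> and infinity already, so one further omitted value
  \<open>w\<close> would make them normal near \<open>z\<close>. Hence no nonzero point is
  exceptional.\<close>

lemma julia_blow_up:
  assumes z: "z \<in> julia_set f" and U: "open U" "z \<in> U" and w: "w \<noteq> 0"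
  obtains k where "k \<ge> 1" "w \<in> (f ^^ k) ` U"
proof (rule ccontr)
  assume "\<not> thesis"
  then have no: "\<And>k. k \<ge> 1 \<Longrightarrow> w \<notin> (f ^^ k) ` U" using that by blast
  have z0: "z \<noteq> 0" "z \<notin> fatou_set f" using z by (auto simp: julia_set_def)
  have "open (U \<inter> punctured_plane)" "z \<in> U \<inter> punctured_plane"
    using U z0 open_punctured_plane by auto
  then obtain e where e: "e > 0" "ball z e \<subseteq> U \<inter> punctured_plane"
    using open_contains_ball by blast
  have "normal_family_on (ball z e) {f ^^ n |n. n \<ge> 1}"
  proof (rule normal_family_on_omitting[of _ z w])
    show "h holomorphic_on ball z e" if "h \<in> {f ^^ n |n. n \<ge> 1}" for h
      using that e by (auto intro: holomorphic_on_subset[OF iter_holomorphic])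
    show "h y \<noteq> 0 \<and> h y \<noteq> w" if h: "h \<in> {f ^^ n |n. n \<ge> 1}" and y: "y \<in> ball z e" for h y
    proof -
      obtain n where n: "n \<ge> 1" "h = f ^^ n" using h by blast
      have "y \<in> U" "y \<noteq> 0" using y e by auto
      then show ?thesis using no[OF n(1)] n(2) iter_nonzero by auto
    qed
  qed (use e w in auto)
  then have "z \<in> fatou_set f"
    unfolding fatou_set_def using e z0 by (auto intro!: exI[of _ "ball z e"])
  then show False using z0 by blast
qed

section \<open>Complete invariance of the escaping, Fatou and Julia sets\<close>

lemma escaping_set_iff:
  "z \<in> escaping_set f \<longleftrightarrow> z \<noteq> 0 \<and> (\<forall>r>1. \<forall>\<^sub>F k in sequentially. (f ^^ k) z \<notin> closed_annulus r)"
  unfolding escaping_set_def omega_limit_set_def using escaping_sequence_iff[of "\<lambda>k. (f ^^ k) z"]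
  by simp

lemma escaping_set_invariant:
  assumes "z \<noteq> 0" shows "f z \<in> escaping_set f \<longleftrightarrow> z \<in> escaping_set f"
proof -
  have "(\<forall>\<^sub>F k in sequentially. (f ^^ k) (f z) \<notin> closed_annulus r) \<longleftrightarrow>
        (\<forall>\<^sub>F k in sequentially. (f ^^ k) z \<notin> closed_annulus r)" for r
    using eventually_sequentially_Suc[of "\<lambda>k. (f ^^ k) z \<notin> closed_annulus r"]
    by (simp add: funpow_swap1)
  then show ?thesis unfolding escaping_set_iff using assms f_nonzero by simp
qed

text \<open>Near \<open>z\<close> an iterate is the previous iterate composed with \<open>f\<close>,
  so normality near \<open>f z\<close> pulls back along \<open>f\<close>.\<close>

lemma fatou_set_backward:
  assumes z: "z \<noteq> 0" and fz: "f z \<in> fatou_set f"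
  shows "z \<in> fatou_set f"
proof -
  obtain U where U: "open U" "f z \<in> U" "U \<subseteq> punctured_plane"
    and nf: "normal_family_on U {f ^^ n |n. n \<ge> 1}"
    using fz by (auto simp: fatou_set_def)
  let ?V = "f -` U \<inter> punctured_plane"
  have cf: "continuous_on punctured_plane f" using f_holomorphic holomorphic_on_imp_continuous_on by blast
  have V: "open ?V" "z \<in> ?V"
    using continuous_on_open_vimage[OF open_punctured_plane] cf U z by (auto simp: Int_commute)
  have "normal_family_on ?V {f ^^ n |n. n \<ge> 1}"
    unfolding normal_family_on_def
  proof (intro allI impI)
    fix s :: "nat \<Rightarrow> complex \<Rightarrow> complex" assume s: "range s \<subseteq> {f ^^ n |n. n \<ge> 1}"
    then have "\<exists>N. \<forall>k. s k = f ^^ N k \<and> N k \<ge> 1" by (intro choice) blast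
    then obtain N where N: "\<And>k. s k = f ^^ N k" "\<And>k. N k \<ge> 1" by blast
    show "\<exists>(r :: nat \<Rightarrow> nat) g. strict_mono r \<and> (\<forall>K. compact K \<and> K \<subseteq> ?V \<longrightarrow>
        uniform_limit K (\<lambda>k z. to_sphere (s (r k) z)) g sequentially)"
    \<comment> \<open>Removing one iteration from exponent 1 would give the identity, which the
      family does not include. If exponent 1 occurs infinitely often, a constant subsequence
      converges; otherwise all exponents can be taken at least 2.\<close>
    proof (cases "infinite {k. N k = 1}")
      case True
      from infinite_enumerate[OF this] obtain q :: "nat \<Rightarrow> nat"
        where q: "strict_mono q" "\<And>n. N (q n) = 1" by auto
      have "uniform_limit K (\<lambda>k z. to_sphere (s (q k) z)) (\<lambda>z. to_sphere (f z)) sequentially" for K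
        using N(1) q(2) by (simp add: uniform_limit_const)
      then show ?thesis using q(1) by blast
    next
      case False
      have "N k = 1 \<or> N k \<ge> 2" for k using N(2)[of k] by linarith
      then have "UNIV = {k. N k = 1} \<union> {k. N k \<ge> 2}" by auto
      then have "infinite {k. N k \<ge> 2}" using False by (metis finite_Un infinite_UNIV_nat)
      from infinite_enumerate[OF this] obtain q :: "nat \<Rightarrow> nat"
        where q: "strict_mono q" "\<And>n. N (q n) \<ge> 2" by auto
      have "range (\<lambda>k. f ^^ (N (q k) - 1)) \<subseteq> {f ^^ n |n. n \<ge> 1}"
      proof (rule image_subsetI)
        fix k have "N (q k) - 1 \<ge> 1" using q(2)[of k] by linarith
        then show "f ^^ (N (q k) - 1) \<in> {f ^^ n |n. n \<ge> 1}" by blast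
      qed
      then obtain r :: "nat \<Rightarrow> nat" and g where r: "strict_mono r" and
        lim: "\<And>K. compact K \<Longrightarrow> K \<subseteq> U \<Longrightarrow>
          uniform_limit K (\<lambda>k z. to_sphere ((f ^^ (N (q (r k)) - 1)) z)) g sequentially"
        using nf unfolding normal_family_on_def by meson
      have eq: "(f ^^ (N (q k) - 1)) (f z) = s (q k) z" for k z
      proof -
        have "N (q k) = Suc (N (q k) - 1)" using q(2)[of k] by simp
        then have "s (q k) z = (f ^^ Suc (N (q k) - 1)) z" using N(1) by metis
        then show ?thesis by (simp add: funpow_swap1)
      qed
      have "uniform_limit K (\<lambda>k z. to_sphere (s (q (r k)) z)) (\<lambda>z. g (f z)) sequentially"
        if K: "compact K" "K \<subseteq> ?V" for K
      proof -
        have "compact (f ` K)" "f ` K \<subseteq> U"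
          using K by (auto intro!: compact_continuous_image continuous_on_subset[OF cf])
        from uniform_limit_compose'[OF lim[OF this], of f K]
        have "uniform_limit K (\<lambda>k z. to_sphere ((f ^^ (N (q (r k)) - 1)) (f z))) (\<lambda>z. g (f z)) sequentially"
          by blast
        then show ?thesis by (simp only: eq)
      qed
      then show ?thesis
        using strict_mono_o[OF q(1) r] by (intro exI[of _ "q \<circ> r"] exI[of _ "\<lambda>z. g (f z)"]) auto
    qed
  qed
  then show ?thesis unfolding fatou_set_def using V z by blast
qed

lemma fatou_set_forward:
  assumes z: "z \<in> fatou_set f"
  shows "f z \<in> fatou_set f"
proof -
  obtain U where U: "open U" "z \<in> U" "U \<subseteq> punctured_plane"
    and nf: "normal_family_on U {f ^^ n |n. n \<ge> 1}"
    using z by (auto simp: fatou_set_def)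
  obtain e where e: "e > 0" "cball z e \<subseteq> U" using U open_contains_cball by blast
  let ?V = "f ` ball z e"
  have b: "ball z e \<subseteq> cball z e" by auto
  have bP: "y \<noteq> 0" if "y \<in> ball z e" for y using that b e(2) U(3) by blast
  have V: "open ?V"
    using open_f_image[OF open_ball] bP[of 0] by blast
  have fzV: "f z \<in> ?V" using e by simp
  have VP: "?V \<subseteq> punctured_plane"
    by (rule image_subsetI) (simp add: bP f_nonzero)
  have "normal_family_on ?V {f ^^ n |n. n \<ge> 1}"
    unfolding normal_family_on_def
  proof (intro allI impI)
    fix s :: "nat \<Rightarrow> complex \<Rightarrow> complex" assume s: "range s \<subseteq> {f ^^ n |n. n \<ge> 1}"
    have "range (\<lambda>k. s k \<circ> f) \<subseteq> {f ^^ n |n. n \<ge> 1}"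
    proof (rule image_subsetI)
      fix k obtain n where "s k = f ^^ n" using s by blast
      then have "s k \<circ> f = f ^^ Suc n" by (simp only: funpow_Suc_right)
      then show "s k \<circ> f \<in> {f ^^ n |n. n \<ge> 1}" by (intro CollectI exI[of _ "Suc n"]) simp
    qed
    then obtain r :: "nat \<Rightarrow> nat" and g where r: "strict_mono r" and
      lim: "\<And>K. compact K \<Longrightarrow> K \<subseteq> U \<Longrightarrow>
        uniform_limit K (\<lambda>k z. to_sphere ((s (r k) \<circ> f) z)) g sequentially"
      using nf unfolding normal_family_on_def by meson
    \<comment> \<open>An arbitrary section of \<open>f\<close>, possibly discontinuous, so that the
      image of a compact set under \<open>p\<close> need not be compact. Uniform convergence is
      therefore taken on the whole \<open>cball z e\<close>, which contains all values of
      \<open>p\<close>.\<close>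
    define p where "p w = (SOME y. y \<in> ball z e \<and> f y = w)" for w
    have p: "p w \<in> ball z e \<and> f (p w) = w" if "w \<in> ?V" for w
      unfolding p_def by (rule someI_ex) (use that in blast)
    have "uniform_limit K (\<lambda>k z. to_sphere (s (r k) z)) (\<lambda>w. g (p w)) sequentially"
      if K: "compact K" "K \<subseteq> ?V" for K
    proof -
      have pK: "p \<in> K \<rightarrow> cball z e" using p K b by blast
      have "uniform_limit K (\<lambda>k w. to_sphere (s (r k) (f (p w)))) (\<lambda>w. g (p w)) sequentially"
        using uniform_limit_compose'[OF lim[OF compact_cball e(2)] pK] by (simp add: o_def)
      moreover have "f (p w) = w" if "w \<in> K" for w using p K that by blast
      ultimately show ?thesis
        by (subst (asm) uniform_limit_cong'[where g = "\<lambda>k w. to_sphere (s (r k) w)" and i = "\<lambda>w. g (p w)"]) auto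
    qed
    then show "\<exists>(r :: nat \<Rightarrow> nat) g. strict_mono r \<and> (\<forall>K. compact K \<and> K \<subseteq> ?V \<longrightarrow>
        uniform_limit K (\<lambda>k z. to_sphere (s (r k) z)) g sequentially)"
      using r by blast
  qed
  then show ?thesis unfolding fatou_set_def using V fzV VP by blast
qed

lemma julia_set_invariant:
  assumes "z \<noteq> 0" shows "f z \<in> julia_set f \<longleftrightarrow> z \<in> julia_set f"
proof -
  have "f z \<in> fatou_set f \<longleftrightarrow> z \<in> fatou_set f"
    using assms fatou_set_forward fatou_set_backward by blast
  then show ?thesis using f_nonzero[OF assms] assms by (simp add: julia_set_def)
qed

end


section \<open>The Julia set is nonempty\<close>

text \<open>Hurwitz's theorem on the sphere. Near a zero of the limit everything stays away from
  infinity, so convergence is uniform in the plane; a nonconstant limit of zero-free functions has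
  no zeros, hence the zero set of the limit is open as well as closed.\<close>

lemma normal_limit_constant_zero:
  fixes h :: "nat \<Rightarrow> complex \<Rightarrow> complex"
  assumes B: "open B" "connected B"
    and hol: "\<And>n. h n holomorphic_on B" and nz: "\<And>n z. z \<in> B \<Longrightarrow> h n z \<noteq> 0"
    and lim: "\<And>K. compact K \<Longrightarrow> K \<subseteq> B \<Longrightarrow> uniform_limit K (\<lambda>n z. to_sphere (h n z)) g sequentially"
    and a: "a \<in> B" "g a = to_sphere 0" and b: "b \<in> B"
  shows "g b = to_sphere 0"
proof -
  let ?p = "\<lambda>(w, t). w /\<^sub>R (1 - t) :: complex"
  let ?Z = "{z \<in> B. g z = to_sphere 0}"
  have hc: "continuous_on B (h n)" for n using hol holomorphic_on_imp_continuous_on by blast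
  have cg: "continuous_on B g"
  proof (rule continuous_at_imp_continuous_on, rule ballI)
    fix z assume "z \<in> B"
    then obtain e where e: "e > 0" "cball z e \<subseteq> B" using B open_contains_cball by blast
    have "continuous_on (cball z e) g"
      by (rule uniform_limit_theorem[OF _ lim[OF compact_cball e(2)]])
        (auto intro!: always_eventually continuous_intros continuous_on_subset[OF hc e(2)])
    then show "isCont g z" by (rule continuous_on_interior) (use e in auto)
  qed
  have "closedin (top_of_set B) ?Z"
    by (rule continuous_closedin_preimage_constant[OF cg])
  moreover have "open ?Z"
    unfolding open_contains_ball
  proof
    fix z assume z: "z \<in> ?Z"
    have "continuous (at z) g" using cg B z continuous_on_eq_continuous_at by blast
    then have "continuous (at z) (\<lambda>z. snd (g z))" by (intro continuous_intros)
    \<comment> \<open>The height of \<open>to_sphere 0\<close> is -1. Heights of \<open>g\<close>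
      below -1/2 and an error below 1/4 keep the functions in the closed lower half of the sphere,
      where projection to the plane is uniformly continuous.\<close>
    moreover have "snd (g z) < -1/2" using z by (simp add: to_sphere_def)
    ultimately have "\<forall>\<^sub>F y in at z. snd (g y) < -1/2" by (simp add: continuous_at order_tendstoD(2))
    then obtain d where d: "d > 0" "\<And>y. y \<noteq> z \<Longrightarrow> dist y z < d \<Longrightarrow> snd (g y) < -1/2"
      unfolding eventually_at by blast
    obtain e where e: "e > 0" "cball z e \<subseteq> B" using B z open_contains_cball by blast
    define r where "r = min e (d / 2)"
    have r: "r > 0" "cball z r \<subseteq> B" using e d by (auto simp: r_def)
    have gr: "snd (g y) < -1/2" if "y \<in> cball z r" for y
      using that d \<open>snd (g z) < -1/2\<close> by (cases "y = z") (auto simp: r_def dist_commute)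
    have "uniform_limit (cball z r) (\<lambda>n y. ?p (to_sphere (h n y))) (\<lambda>y. ?p (g y)) sequentially"
    proof (rule uniform_limit_compose_uniformly_continuous_on[OF lim[OF compact_cball r(2)]])
      let ?C = "cball 0 1 \<inter> {p. snd p \<le> (0::real)} :: (complex \<times> real) set"
      have cC: "compact ?C"
        by (intro compact_Int_closed compact_cball closed_Collect_le continuous_intros)
      then show "closed ?C" by (rule compact_imp_closed)
      show "uniformly_continuous_on ?C ?p"
        using cC unfolding case_prod_unfold
        by (intro compact_uniformly_continuous continuous_intros) auto
      have "\<forall>\<^sub>F n in sequentially. \<forall>y\<in>cball z r. dist (to_sphere (h n y)) (g y) < 1/4"
        using lim[OF compact_cball r(2)] by (rule uniform_limitD) simp
      then show "\<forall>\<^sub>F n in sequentially. \<forall>y\<in>cball z r. to_sphere (h n y) \<in> ?C"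
      proof eventually_elim
        case (elim n)
        show ?case
        proof
          fix y assume y: "y \<in> cball z r"
          have "dist (snd (to_sphere (h n y))) (snd (g y)) < 1/4"
            using elim y dist_snd_le order_le_less_trans by blast
          then have "snd (to_sphere (h n y)) \<le> 0" using gr[OF y] unfolding dist_real_def by linarith
          then show "to_sphere (h n y) \<in> ?C" by (simp add: norm_to_sphere)
        qed
      qed
    qed
    then have ul: "uniform_limit (cball z r) h (\<lambda>y. ?p (g y)) sequentially"
      by (simp only: from_sphere_to_sphere)
    let ?G = "\<lambda>y. ?p (g y)"
    have bb: "ball z r \<subseteq> cball z r" by auto
    have "?G constant_on ball z r"
    proof (rule ccontr)
      assume nc: "\<not> ?G constant_on ball z r"
      have hb: "h n holomorphic_on ball z r" for n
        using hol bb r(2) holomorphic_on_subset by blast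
      have "?G z \<noteq> 0"
      proof (rule Hurwitz_no_zeros[where S = "ball z r" and \<F> = h and g = ?G and ?z0.0 = z])
        show "?G holomorphic_on ball z r"
        proof (rule holomorphic_uniform_sequence[OF open_ball hb])
          fix y assume "y \<in> ball z r"
          then obtain d where "d > 0" "cball y d \<subseteq> ball z r"
            using open_ball open_contains_cball by blast
          then show "\<exists>d>0. cball y d \<subseteq> ball z r \<and> uniform_limit (cball y d) h ?G sequentially"
            using uniform_limit_on_subset[OF ul order_trans[OF _ bb]] by (intro exI[of _ d]) blast
        qed
        show "uniform_limit K h ?G sequentially" if "compact K" "K \<subseteq> ball z r" for K
          using uniform_limit_on_subset[OF ul] that bb by blast
        show "h n y \<noteq> 0" if "y \<in> ball z r" for n y
          using that nz bb r(2) by blast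
      qed (use nc hb r in auto)
      moreover have "g z = to_sphere 0" using z by simp
      ultimately show False by (simp add: from_sphere_to_sphere)
    qed
    then obtain c where c: "\<And>y. y \<in> ball z r \<Longrightarrow> ?G y = c" unfolding constant_on_def by blast
    have "c = 0" using c[of z] r z by (simp add: from_sphere_to_sphere)
    have "ball z r \<subseteq> ?Z"
    proof
      fix y assume y: "y \<in> ball z r"
      then have y': "y \<in> cball z r" by simp
      have "(\<lambda>n. h n y) \<longlonglongrightarrow> ?G y" by (rule tendsto_uniform_limitI[OF ul y'])
      then have "(\<lambda>n. h n y) \<longlonglongrightarrow> 0" using c[OF y] \<open>c = 0\<close> by simp
      moreover have "isCont to_sphere 0"
        using continuous_on_to_sphere[OF continuous_on_id, of UNIV]
        by (simp add: continuous_on_eq_continuous_at)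
      ultimately have "(\<lambda>n. to_sphere (h n y)) \<longlonglongrightarrow> to_sphere 0"
        by (rule isCont_tendsto_compose[rotated])
      moreover have "(\<lambda>n. to_sphere (h n y)) \<longlonglongrightarrow> g y"
        by (rule tendsto_uniform_limitI[OF lim[OF compact_cball r(2)] y'])
      ultimately have "g y = to_sphere 0" using LIMSEQ_unique by blast
      then show "y \<in> ?Z" using y' r(2) by blast
    qed
    then show "\<exists>e>0. ball z e \<subseteq> ?Z" using r by blast
  qed
  then have "openin (top_of_set B) ?Z" by (intro open_subset) auto
  ultimately have "?Z = {} \<or> ?Z = B" using B(2) unfolding connected_clopen by blast
  then show ?thesis using a b by blast
qed

text \<open>The half-turn \<open>?t\<close> exchanges the punctures and turns \<open>h n\<close>
  into its reciprocal, which reduces this to the limit zero.\<close>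

lemma normal_limit_constant_infinity:
  fixes h :: "nat \<Rightarrow> complex \<Rightarrow> complex"
  assumes B: "open B" "connected B"
    and hol: "\<And>n. h n holomorphic_on B" and nz: "\<And>n z. z \<in> B \<Longrightarrow> h n z \<noteq> 0"
    and lim: "\<And>K. compact K \<Longrightarrow> K \<subseteq> B \<Longrightarrow> uniform_limit K (\<lambda>n z. to_sphere (h n z)) g sequentially"
    and a: "a \<in> B" "g a = sphere_infinity" and b: "b \<in> B"
  shows "g b = sphere_infinity"
proof -
  let ?t = "\<lambda>p. (cnj (fst p), - snd p) :: complex \<times> real"
  have inf0: "?t sphere_infinity = to_sphere 0" by (simp add: sphere_infinity_def to_sphere_def)
  have tlin: "bounded_linear ?t"
    by (intro bounded_linear_Pair bounded_linear_minus bounded_linear_snd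
        bounded_linear_compose[OF bounded_linear_cnj bounded_linear_fst])
  have "?t (g b) = to_sphere 0"
  proof (rule normal_limit_constant_zero[OF B, of "\<lambda>n z. 1 / h n z" "\<lambda>z. ?t (g z)" a b])
    show "(\<lambda>z. 1 / h n z) holomorphic_on B" for n
      by (intro holomorphic_on_divide holomorphic_on_const hol nz)
    show "1 / h n z \<noteq> 0" if "z \<in> B" for n z using nz[OF that] by simp
    show "uniform_limit K (\<lambda>n z. to_sphere (1 / h n z)) (\<lambda>z. ?t (g z)) sequentially"
      if K: "compact K" "K \<subseteq> B" for K
    proof -
      have "uniform_limit K (\<lambda>n z. ?t (to_sphere (h n z))) (\<lambda>z. ?t (g z)) sequentially"
        by (rule bounded_linear.uniform_limit[OF tlin lim[OF K]])
      moreover have "?t (to_sphere (h n z)) = to_sphere (1 / h n z)" if "z \<in> K" for n z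
        using nz[of z n] that K by (simp add: to_sphere_inverse subset_iff)
      ultimately show ?thesis
        by (subst (asm) uniform_limit_cong'[where g = "\<lambda>n z. to_sphere (1 / h n z)" and i = "\<lambda>z. ?t (g z)"]) auto
    qed
  qed (use a b inf0 in auto)
  then have "?t (?t (g b)) = ?t (?t sphere_infinity)" using inf0 by simp
  then show ?thesis by (simp add: prod_eq_iff)
qed

context punctured_dynamics
begin

text \<open>Along the times at which \<open>b\<close> returns to an annulus, a normal limit is a
  puncture at \<open>a\<close>. By the Hurwitz argument it is the same puncture at \<open>b\<close>,
  although those returns keep it in the annulus.\<close>

lemma escaping_set_normal_domain:
  assumes B: "open B" "connected B" "B \<subseteq> punctured_plane"
    and nf: "normal_family_on B {f ^^ n |n. n \<ge> 1}"
    and a: "a \<in> B" "a \<in> escaping_set f" and b: "b \<in> B"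
  shows "b \<in> escaping_set f"
proof (rule ccontr)
  assume "b \<notin> escaping_set f"
  then obtain r where r: "r > 1" "\<not> (\<forall>\<^sub>F k in sequentially. (f ^^ k) b \<notin> closed_annulus r)"
    using b B(3) unfolding escaping_set_iff by blast
  let ?N = "{k. (f ^^ k) b \<in> closed_annulus r}"
  have "infinite ?N"
  proof
    assume "finite ?N"
    then have "\<forall>\<^sub>F k in sequentially. k \<notin> ?N"
      unfolding cofinite_eq_sequentially[symmetric] by (simp add: eventually_cofinite)
    then show False using r(2) by simp
  qed
  from infinite_enumerate[OF this] obtain q :: "nat \<Rightarrow> nat"
    where q: "strict_mono q" "\<And>k. (f ^^ q k) b \<in> closed_annulus r" by auto
  \<comment> \<open>\<open>Suc\<close> skips \<open>q 0\<close>, which may be 0, while the normal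
    family starts at the first iterate.\<close>
  have "range (\<lambda>k. f ^^ q (Suc k)) \<subseteq> {f ^^ n |n. n \<ge> 1}"
  proof (rule image_subsetI)
    fix k have "q (Suc k) \<ge> 1" using strict_mono_imp_increasing[OF q(1), of "Suc k"] by linarith
    then show "f ^^ q (Suc k) \<in> {f ^^ n |n. n \<ge> 1}" by blast
  qed
  then obtain s :: "nat \<Rightarrow> nat" and g where s: "strict_mono s" and
    lim: "\<And>K. compact K \<Longrightarrow> K \<subseteq> B \<Longrightarrow>
      uniform_limit K (\<lambda>k z. to_sphere ((f ^^ q (Suc (s k))) z)) g sequentially"
    using nf unfolding normal_family_on_def by meson
  have big: "k \<le> q (Suc (s k))" for k
    using strict_mono_imp_increasing[OF q(1), of "Suc (s k)"] strict_mono_imp_increasing[OF s, of k]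
    by linarith
  have pt: "(\<lambda>k. to_sphere ((f ^^ q (Suc (s k))) z)) \<longlonglongrightarrow> g z" if "z \<in> B" for z
    using tendsto_uniform_limitI[OF lim[of "{z}"], of z] that by simp
  have "g a \<in> omega_limit_set f a"
    unfolding omega_limit_set_def
  proof
    fix n
    have "\<forall>\<^sub>F k in sequentially. to_sphere ((f ^^ q (Suc (s k))) a) \<in> {to_sphere ((f ^^ k) a) |k. k \<ge> n}"
      using eventually_ge_at_top[of n] by eventually_elim (use big le_trans in blast)
    then have "\<forall>\<^sub>F k in sequentially. to_sphere ((f ^^ q (Suc (s k))) a) \<in> closure {to_sphere ((f ^^ k) a) |k. k \<ge> n}"
      by eventually_elim (rule subsetD[OF closure_subset])
    from Lim_in_closed_set[OF closed_closure this _ pt[OF a(1)]]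
    show "g a \<in> closure {to_sphere ((f ^^ k) a) |k. k \<ge> n}" by simp
  qed
  then have ga: "g a = to_sphere 0 \<or> g a = sphere_infinity"
    using a(2) by (auto simp: escaping_set_def)
  have "compact (to_sphere ` closed_annulus r)"
    by (intro compact_continuous_image continuous_intros compact_closed_annulus)
  from Lim_in_closed_set[OF compact_imp_closed[OF this] _ _ pt[OF b]]
  have gb: "g b \<in> to_sphere ` closed_annulus r" using q(2) by simp
  have hol: "(f ^^ n) holomorphic_on B" for n
    using iter_holomorphic B(3) holomorphic_on_subset by blast
  have nz: "(f ^^ n) z \<noteq> 0" if "z \<in> B" for n z
    using iter_nonzero that B(3) by blast
  have "g b = to_sphere 0 \<or> g b = sphere_infinity"
    using ga normal_limit_constant_zero[OF B(1,2) hol nz lim a(1) _ b]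
      normal_limit_constant_infinity[OF B(1,2) hol nz lim a(1) _ b] by blast
  then show False using gb punctures_notin_annulus[of r] r(1) by auto
qed

text \<open>Without fixed points, f(z)/z omits 0 and 1. Great Picard at infinity then gives a finite
  limit of the quotient or of its reciprocal, against the superlinear growth of \<open>f\<close> or
  of \<open>1 / f\<close>.\<close>

lemma ex_fixed_point: "\<exists>p. p \<noteq> 0 \<and> f p = p"
proof (rule ccontr)
  assume no: "\<not> ?thesis"
  define F where "F w = f (1 / w) * w" for w
  have hol: "F holomorphic_on UNIV - {0}"
    using holomorphic_flip[OF f_holomorphic] unfolding F_def Compl_eq_Diff_UNIV
    by (intro holomorphic_intros)
  have om: "F w \<noteq> 0 \<and> F w \<noteq> 1" if "w \<in> UNIV - {0}" for w
  proof -
    have "f (1 / w) \<noteq> 0" "f (1 / w) \<noteq> 1 / w" using that no f_nonzero[of "1 / w"] by auto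
    then show ?thesis using that by (auto simp: F_def field_simps)
  qed
  obtain l where "(F \<longlongrightarrow> l) (at 0) \<or> ((inverse \<circ> F) \<longlongrightarrow> l) (at 0)"
    by (rule great_Picard[OF open_UNIV UNIV_I zero_neq_one hol om]) auto
  \<comment> \<open>Serves both cases of Picard's alternative. For \<open>G\<close> the reciprocal
    of \<open>F\<close> and \<open>g\<close> that of \<open>f\<close>, the bound \<open>gG\<close>
    loses a factor of modulus |z|^2, which is harmless for |z| at least 1.\<close>
  moreover have False if g: "transcendental_self_map g" and G: "(G \<longlongrightarrow> l) (at 0)"
    and gG: "\<And>z. cmod z \<ge> 1 \<Longrightarrow> cmod (g z) \<le> cmod (G (1 / z)) * cmod z" for g G :: "complex \<Rightarrow> complex"
  proof -
    have "\<forall>\<^sub>F w in at 0. dist (G w) l < 1" using G by (rule tendstoD) simp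
    then obtain d where d: "d > 0" "\<And>w. w \<noteq> 0 \<Longrightarrow> cmod w < d \<Longrightarrow> dist (G w) l < 1"
      unfolding eventually_at by (auto simp: dist_norm)
    have "\<forall>\<^sub>F r in at_top. (cmod l + 1) * r < max_modulus g r"
      by (rule eventually_max_modulus_growth[OF g])
    moreover have "\<forall>\<^sub>F r in at_top. r > max 1 (1 / d)" by (rule eventually_gt_at_top)
    ultimately have "\<forall>\<^sub>F r in at_top. (cmod l + 1) * r < max_modulus g r \<and> r > max 1 (1 / d)"
      by (rule eventually_conj)
    then obtain r where r: "(cmod l + 1) * r < max_modulus g r" "r > max 1 (1 / d)"
      using eventually_happens by (metis (no_types, lifting) trivial_limit_at_top_linorder)
    then have "r > 0" by auto
    from max_modulus_attained[OF g one_neq_zero this]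
    obtain z where z: "cmod z = r" "cmod (g z) = max_modulus g r" by blast
    have "1 / r < d" using r d \<open>r > 0\<close> by (simp add: divide_less_eq mult.commute)
    then have "dist (G (1 / z)) l < 1" using z \<open>r > 0\<close> by (intro d) (auto simp: norm_divide)
    then have "cmod (G (1 / z)) \<le> cmod l + 1"
      using norm_triangle_ineq2[of "G (1/z)" l] by (simp add: dist_norm)
    then have "cmod (G (1 / z)) * r \<le> (cmod l + 1) * r" using \<open>r > 0\<close> by (intro mult_right_mono) auto
    moreover have "cmod (g z) \<le> cmod (G (1 / z)) * r" using gG[of z] z r by simp
    ultimately show False using z r by linarith
  qed
  note * = this
  have "cmod (f z) \<le> cmod (F (1 / z)) * cmod z" if "cmod z \<ge> 1" for z
    using that by (auto simp: F_def norm_mult norm_divide)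
  moreover have "cmod (1 / f z) \<le> cmod ((inverse \<circ> F) (1 / z)) * cmod z" if z: "cmod z \<ge> 1" for z
  proof -
    have "z \<noteq> 0" using z by auto
    then have e: "cmod ((inverse \<circ> F) (1 / z)) * cmod z = cmod (1 / f z) * (cmod z * cmod z)"
      by (simp add: F_def norm_mult norm_divide norm_inverse field_simps)
    have "1 \<le> cmod z * cmod z" using mult_mono[OF z z] by simp
    then have "cmod (1 / f z) * 1 \<le> cmod (1 / f z) * (cmod z * cmod z)" by (intro mult_left_mono) auto
    then show ?thesis unfolding e by simp
  qed
  ultimately show False using *[OF tsm] *[OF tsm_inverse[OF tsm]] by blast
qed

lemma normal_family_on_subset:
  "normal_family_on U F \<Longrightarrow> V \<subseteq> U \<Longrightarrow> normal_family_on V F"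
  unfolding normal_family_on_def by (meson order_trans)

lemma julia_set_nonempty:
  assumes "escaping_set f \<noteq> {}"
  shows "julia_set f \<noteq> {}"
proof
  assume J: "julia_set f = {}"
  let ?I = "escaping_set f"
  have I0: "?I \<subseteq> punctured_plane" unfolding escaping_set_def by blast
  have loc: "\<exists>e>0. ball z e \<subseteq> punctured_plane \<and> (ball z e \<subseteq> ?I \<or> ball z e \<inter> ?I = {})"
    if z: "z \<noteq> 0" for z
  proof -
    have "z \<in> fatou_set f" using J z by (auto simp: julia_set_def)
    then obtain U where U: "open U" "z \<in> U" "U \<subseteq> punctured_plane"
      and nf: "normal_family_on U {f ^^ n |n. n \<ge> 1}" by (auto simp: fatou_set_def)
    obtain e where e: "e > 0" "ball z e \<subseteq> U" using U open_contains_ball by blast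
    have "b \<in> ?I" if "a \<in> ball z e" "a \<in> ?I" "b \<in> ball z e" for a b
      using escaping_set_normal_domain[OF open_ball connected_ball _ normal_family_on_subset[OF nf e(2)] that]
        e U by blast
    then show ?thesis using e U by blast
  qed
  have "open ?I"
    unfolding open_contains_ball using loc I0 by (metis ComplD IntI centre_in_ball empty_iff singletonI subsetD)
  moreover have "open (punctured_plane - ?I)"
    unfolding open_contains_ball
  proof
    fix z assume z: "z \<in> punctured_plane - ?I"
    then obtain e where "e > 0" "ball z e \<subseteq> punctured_plane" "ball z e \<subseteq> ?I \<or> ball z e \<inter> ?I = {}"
      using loc[of z] by auto
    moreover have "z \<in> ball z e" using \<open>e > 0\<close> by simp
    ultimately show "\<exists>e>0. ball z e \<subseteq> punctured_plane - ?I" using z by blast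
  qed
  ultimately have "punctured_plane \<inter> ?I = {} \<or> punctured_plane \<inter> (punctured_plane - ?I) = {}"
    using connectedD[OF connected_punctured_plane, of ?I "punctured_plane - ?I"] by blast
  then have all: "punctured_plane \<subseteq> ?I" using assms I0 by blast
  obtain p where p: "p \<noteq> 0" "f p = p" using ex_fixed_point by blast
  have fp: "(f ^^ k) p = p" for k by (induction k) (auto simp: p)
  obtain r where r: "r > 1" "p \<in> closed_annulus r" using closed_annulus_exhausts p(1) by blast
  have "p \<in> ?I" using all p(1) by blast
  then have "\<forall>\<^sub>F k in sequentially. (f ^^ k) p \<notin> closed_annulus r" using r(1) escaping_set_iff by blast
  then show False using fp r by simp
qed

end


section \<open>Levels of fast escape\<close>

text \<open>Inverting source and target reduces all four combinations of punctures to the behaviour of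
  the maximum modulus at infinity.\<close>

primrec flip :: "puncture \<Rightarrow> 'a::field \<Rightarrow> 'a" where
  "flip Infty x = x"
| "flip Zero x = 1 / x"

lemma flip_flip [simp]: "flip p (flip p x) = x"
  by (cases p) auto

lemma flip_pos_iff [simp]: "flip p (x :: real) > 0 \<longleftrightarrow> x > 0"
  by (cases p) auto

lemma norm_flip: "cmod (flip p z) = flip p (cmod z)"
  by (cases p) (auto simp: norm_divide)

lemma flip_eq_0_iff [simp]: "flip p x = 0 \<longleftrightarrow> x = 0"
  by (cases p) auto

text \<open>\<open>f\<close> in coordinates that place the source puncture \<open>p\<close> and the
  target puncture \<open>q\<close> at infinity. Its maximum modulus at \<open>r\<close> is M(r),
  M(1/r), 1/m(r) or 1/m(1/r).\<close>

definition flip_map :: "puncture \<Rightarrow> puncture \<Rightarrow> (complex \<Rightarrow> complex) \<Rightarrow> complex \<Rightarrow> complex" where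
  "flip_map p q f z = flip q (f (flip p z))"

lemma tsm_flip_map:
  assumes "transcendental_self_map f" shows "transcendental_self_map (flip_map p q f)"
proof -
  have "transcendental_self_map (\<lambda>z. f (flip p z))"
    using assms tsm_flip by (cases p) auto
  then show ?thesis using tsm_inverse by (cases q) (auto simp: flip_map_def[abs_def])
qed

lemma max_modulus_flip: "max_modulus (\<lambda>z. f (flip p z)) r = max_modulus f (flip p r)"
proof (cases p)
  case Zero
  have "z \<in> (\<lambda>z. 1 / z) ` sphere 0 r" if "z \<in> sphere 0 (1 / r)" for z :: complex
    using that by (intro image_eqI[of _ _ "1 / z"]) (auto simp: norm_divide)
  then have eq: "(\<lambda>z. 1 / z) ` sphere (0::complex) r = sphere 0 (1 / r)"
    by (auto simp: norm_divide)
  have "(\<lambda>z. cmod (f z)) ` sphere 0 (1 / r) = (\<lambda>z. cmod (f (1 / z))) ` sphere 0 r"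
    by (simp only: image_image flip: eq)
  then show ?thesis by (simp add: max_modulus_def Zero)
qed simp

lemma min_modulus_conv_max_modulus:
  assumes f: "transcendental_self_map f" and r: "r > 0"
  shows "min_modulus f r = 1 / max_modulus (\<lambda>z. 1 / f z) r"
proof -
  have g: "transcendental_self_map (\<lambda>z. 1 / f z)" using tsm_inverse[OF f] .
  obtain w where w: "cmod w = r" "cmod (1 / f w) = max_modulus (\<lambda>z. 1 / f z) r"
    using max_modulus_attained[OF g one_neq_zero r] by blast
  have "min_modulus f r = cmod (f w)"
    unfolding min_modulus_def
  proof (rule cInf_eq_minimum)
    show "cmod (f w) \<in> (\<lambda>z. cmod (f z)) ` sphere 0 r" using w by auto
    fix x assume "x \<in> (\<lambda>z. cmod (f z)) ` sphere 0 r"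
    then obtain z where z: "cmod z = r" "x = cmod (f z)" by auto
    have "z \<noteq> 0" "w \<noteq> 0" using z w r by auto
    then have "f z \<noteq> 0" "f w \<noteq> 0" using tsm_nonzero[OF f] by auto
    moreover have "cmod (1 / f z) \<le> cmod (1 / f w)"
      using cmod_le_max_modulus(1)[OF g \<open>z \<noteq> 0\<close>] z w by simp
    ultimately show "cmod (f w) \<le> x" using z by (simp add: norm_divide divide_simps split: if_splits)
  qed
  then show ?thesis using w(2) by (simp add: norm_divide flip: w(2))
qed

text \<open>The escape radius measured towards the current puncture. It is large for either
  puncture, so the two opposite inequalities in the fast escaping set become a single lower
  bound.\<close>

primrec escape_level :: "(complex \<Rightarrow> complex) \<Rightarrow> real \<Rightarrow> (nat \<Rightarrow> puncture) \<Rightarrow> nat \<Rightarrow> real" where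
  "escape_level f R e 0 = R"
| "escape_level f R e (Suc n) = max_modulus (flip_map (e n) (e (Suc n)) f) (escape_level f R e n)"

text \<open>The meaning of a sufficiently large starting radius: the factor 2 drives the levels to
  infinity geometrically, and strict monotonicity allows a level bound to be pulled back one
  step.\<close>

definition growth_radius :: "(complex \<Rightarrow> complex) \<Rightarrow> real \<Rightarrow> bool" where
  "growth_radius f R \<longleftrightarrow> R > 1 \<and> (\<forall>p q.
     (\<forall>r\<ge>R. 2 * r < max_modulus (flip_map p q f) r) \<and>
     (\<forall>r s. R \<le> r \<longrightarrow> r < s \<longrightarrow> max_modulus (flip_map p q f) r < max_modulus (flip_map p q f) s))"

lemma eventually_growth_radius:
  assumes f: "transcendental_self_map f"
  shows "\<forall>\<^sub>F R in at_top. growth_radius f R"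
proof -
  have "\<forall>\<^sub>F R in at_top. (\<forall>r\<ge>R. 2 * r < max_modulus (flip_map p q f) r) \<and>
     (\<forall>r s. R \<le> r \<longrightarrow> r < s \<longrightarrow> max_modulus (flip_map p q f) r < max_modulus (flip_map p q f) s)" for p q
  proof (rule eventually_conj)
    have "\<forall>\<^sub>F r in at_top. 2 * r < max_modulus (flip_map p q f) r"
      by (rule eventually_max_modulus_growth[OF tsm_flip_map[OF f]])
    then show "\<forall>\<^sub>F R in at_top. \<forall>r\<ge>R. 2 * r < max_modulus (flip_map p q f) r"
      unfolding eventually_at_top_linorder by (meson order_trans)
    obtain R where R: "\<forall>r s. R \<le> r \<longrightarrow> r < s \<longrightarrow> max_modulus (flip_map p q f) r < max_modulus (flip_map p q f) s"
      using max_modulus_eventually_strict_mono[OF tsm_flip_map[OF f], of p q] by blast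
    then show "\<forall>\<^sub>F R in at_top. \<forall>r s. R \<le> r \<longrightarrow> r < s \<longrightarrow>
        max_modulus (flip_map p q f) r < max_modulus (flip_map p q f) s"
      unfolding eventually_at_top_linorder by (meson order_trans)
  qed
  then have "\<forall>\<^sub>F R in at_top. \<forall>p\<in>{Zero, Infty}. \<forall>q\<in>{Zero, Infty}.
      (\<forall>r\<ge>R. 2 * r < max_modulus (flip_map p q f) r) \<and>
     (\<forall>r s. R \<le> r \<longrightarrow> r < s \<longrightarrow> max_modulus (flip_map p q f) r < max_modulus (flip_map p q f) s)"
    by (intro eventually_ball_finite ballI) auto
  moreover have "\<forall>\<^sub>F R in at_top. R > (1::real)" by (rule eventually_gt_at_top)
  ultimately show ?thesis
  proof eventually_elim
    case (elim R)
    have "p \<in> {Zero, Infty}" for p by (cases p) auto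
    with elim show ?case unfolding growth_radius_def by blast
  qed
qed

locale fast_escape = punctured_dynamics +
  fixes R :: real
  assumes R: "growth_radius f R"
begin

abbreviation L :: "(nat \<Rightarrow> puncture) \<Rightarrow> nat \<Rightarrow> real" where "L \<equiv> escape_level f R"
abbreviation A :: "complex set" where "A \<equiv> fast_escaping_set f R"

lemma R_gt_1: "R > 1"
  and max_modulus_ge_double: "R \<le> r \<Longrightarrow> 2 * r < max_modulus (flip_map p q f) r"
  and max_modulus_less: "R \<le> r \<Longrightarrow> r < s \<Longrightarrow>
    max_modulus (flip_map p q f) r < max_modulus (flip_map p q f) s"
  using R unfolding growth_radius_def by blast+

lemma max_modulus_le: "R \<le> r \<Longrightarrow> r \<le> s \<Longrightarrow>
    max_modulus (flip_map p q f) r \<le> max_modulus (flip_map p q f) s"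
  using max_modulus_less[of r s p q] by (cases "r = s") auto

lemma escape_level_ge: "R * 2 ^ n \<le> L e n"
proof (induction n)
  case (Suc n)
  have "R * 1 \<le> R * 2 ^ n" using R_gt_1 by (intro mult_left_mono) auto
  then have "2 * L e n < L e (Suc n)" using Suc max_modulus_ge_double[of "L e n"] by simp
  then show ?case using Suc by simp
qed simp

lemma escape_level_ge_R: "R \<le> L e n"
proof -
  have "R * 1 \<le> R * 2 ^ n" using R_gt_1 by (intro mult_left_mono) auto
  then show ?thesis using escape_level_ge[of n e] by simp
qed

lemma escape_radius_conv_level: "escape_radius f R e n = flip (e n) (L e n)"
proof (induction n)
  case 0
  show ?case by (cases "e 0") auto
next
  case (Suc n)
  have pos: "L e n > 0" using escape_level_ge_R[of e n] R_gt_1 by simp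
  show ?case
  proof (cases "e (Suc n)")
    case Infty
    then show ?thesis using Suc max_modulus_flip[of f "e n"] by (simp add: flip_map_def[abs_def])
  next
    case Zero
    have "min_modulus f (flip (e n) (L e n)) = 1 / max_modulus (\<lambda>z. 1 / f z) (flip (e n) (L e n))"
      using pos by (intro min_modulus_conv_max_modulus[OF tsm]) simp
    then show ?thesis
      using Zero Suc max_modulus_flip[of "\<lambda>z. 1 / f z" "e n"] by (simp add: flip_map_def[abs_def])
  qed
qed

lemma fast_escaping_set_iff:
  "z \<in> A \<longleftrightarrow> z \<noteq> 0 \<and> (\<exists>l e. \<forall>n. L e n \<le> flip (e n) (cmod ((f ^^ (n + l)) z)))"
proof -
  have "((e n = Infty \<longrightarrow> cmod ((f ^^ (n + l)) z) \<ge> escape_radius f R e n) \<and>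
        (e n = Zero \<longrightarrow> cmod ((f ^^ (n + l)) z) \<le> escape_radius f R e n)) \<longleftrightarrow>
        L e n \<le> flip (e n) (cmod ((f ^^ (n + l)) z))" if "z \<noteq> 0" for e n l
  proof -
    have "L e n > 0" using escape_level_ge_R[of e n] R_gt_1 by simp
    moreover have "cmod ((f ^^ (n + l)) z) > 0" using iter_nonzero[OF that] by simp
    ultimately show ?thesis
      unfolding escape_radius_conv_level by (cases "e n") (auto simp: field_simps)
  qed
  then show ?thesis by (cases "z = 0") (simp_all add: fast_escaping_set_def)
qed

text \<open>Restarting at \<open>R\<close> after \<open>m\<close> steps starts no higher than the
  level already reached, and monotonicity preserves the inequality. Hence an initial part of an
  itinerary may be forgotten.\<close>

lemma escape_level_shift: "L (\<lambda>i. e (i + m)) n \<le> L e (n + m)"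
proof (induction n)
  case 0
  show ?case using escape_level_ge_R by simp
next
  case (Suc n)
  show ?case using max_modulus_le[OF escape_level_ge_R Suc] by simp
qed

lemma fast_escaping_eventually:
  assumes "z \<noteq> 0" "\<And>n. n \<ge> m \<Longrightarrow> L e n \<le> flip (e n) (cmod ((f ^^ (n + l)) z))"
  shows "z \<in> A"
proof -
  have "L (\<lambda>i. e (i + m)) n \<le> flip (e (n + m)) (cmod ((f ^^ (n + (m + l))) z))" for n
    using escape_level_shift[of e m n] assms(2)[of "n + m"] by (simp add: add.assoc)
  then show ?thesis
    unfolding fast_escaping_set_iff using assms(1)
    by (intro conjI exI[of _ "m + l"] exI[of _ "\<lambda>i. e (i + m)"]) auto
qed

lemma fast_escaping_set_invariant:
  assumes "z \<noteq> 0" shows "f z \<in> A \<longleftrightarrow> z \<in> A"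
proof
  assume "f z \<in> A"
  then obtain l e where "\<And>n. L e n \<le> flip (e n) (cmod ((f ^^ (n + l)) (f z)))"
    unfolding fast_escaping_set_iff by blast
  then have "L e n \<le> flip (e n) (cmod ((f ^^ (n + Suc l)) z))" for n
    by (simp add: funpow_swap1)
  then show "z \<in> A" unfolding fast_escaping_set_iff using assms by blast
next
  assume "z \<in> A"
  then obtain l e where le: "\<And>n. L e n \<le> flip (e n) (cmod ((f ^^ (n + l)) z))"
    unfolding fast_escaping_set_iff by blast
  \<comment> \<open>The delay \<open>l\<close> may be 0 and cannot be lowered, so the first symbol
    of the itinerary is dropped instead.\<close>
  have "L (\<lambda>i. e (i + 1)) n \<le> flip (e (n + 1)) (cmod ((f ^^ (n + l)) (f z)))" for n
    using escape_level_shift[of e 1 n] le[of "n + 1"] by (simp add: funpow_swap1)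
  then show "f z \<in> A"
    unfolding fast_escaping_set_iff using f_nonzero[OF assms]
    by (intro conjI exI[of _ l] exI[of _ "\<lambda>i. e (i + 1)"]) auto
qed

lemma fast_escaping_subset_escaping: "A \<subseteq> escaping_set f"
proof
  fix z assume "z \<in> A"
  then obtain l e where z: "z \<noteq> 0" and le: "\<And>n. L e n \<le> flip (e n) (cmod ((f ^^ (n + l)) z))"
    unfolding fast_escaping_set_iff by blast
  have "\<forall>\<^sub>F k in sequentially. (f ^^ k) z \<notin> closed_annulus r" if r: "r > 1" for r
  proof -
    obtain m where m: "r < 2 ^ m" using real_arch_pow[of 2 r] by auto
    have "(f ^^ (n + l)) z \<notin> closed_annulus r" if "n \<ge> m" for n
    proof
      assume mem: "(f ^^ (n + l)) z \<in> closed_annulus r"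
      have "cmod ((f ^^ (n + l)) z) > 0" using iter_nonzero[OF z] by simp
      then have "flip (e n) (cmod ((f ^^ (n + l)) z)) \<le> r"
        using mem r by (cases "e n") (auto simp: closed_annulus_def field_simps)
      moreover have "(2::real) ^ m \<le> 2 ^ n" using that by (intro power_increasing) auto
      moreover have "1 * 2 ^ n \<le> R * 2 ^ n" using R_gt_1 by (intro mult_right_mono) auto
      ultimately show False using le[of n] escape_level_ge[of n e] m by linarith
    qed
    then show ?thesis
      unfolding eventually_sequentially by (intro exI[of _ "m + l"]) (metis add_le_imp_le_right le_add_diff_inverse2 le_add2 le_trans)
  qed
  then show "z \<in> escaping_set f" unfolding escaping_set_iff using z by blast
qed

end


section \<open>Ring domains\<close>

lemma components_Un_closed_disjoint:
  fixes P Q :: "'a::topological_space set"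
  assumes P: "closed P" "connected P" "P \<noteq> {}" and Q: "closed Q" "connected Q" "Q \<noteq> {}"
    and PQ: "P \<inter> Q = {}"
  shows "components (P \<union> Q) = {P, Q}"
proof -
  have *: "X \<in> components (X \<union> Y)"
    if X: "closed X" "connected X" "X \<noteq> {}" and Y: "closed Y" and XY: "X \<inter> Y = {}" for X Y :: "'a set"
    unfolding in_components_maximal
  proof (intro conjI allI impI)
    fix D assume D: "D \<noteq> {} \<and> X \<subseteq> D \<and> D \<subseteq> X \<union> Y \<and> connected D"
    have "Y \<inter> D = {}"
      using X(1) Y XY D X(3) unfolding connected_closed by (metis Int_absorb2 Int_assoc Int_commute Int_empty_left)
    then show "D = X" using D by blast
  qed (use X in auto)
  have p: "P \<in> components (P \<union> Q)" using *[OF P Q(1) PQ] .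
  have q: "Q \<in> components (P \<union> Q)" using *[OF Q P(1)] PQ by (simp add: Un_commute Int_commute)
  have "C = P \<or> C = Q" if C: "C \<in> components (P \<union> Q)" for C
  proof -
    have "C \<noteq> {}" "C \<subseteq> P \<union> Q" using C in_components_nonempty in_components_subset by blast+
    then have "C \<inter> P \<noteq> {} \<or> C \<inter> Q \<noteq> {}" by blast
    then show ?thesis using components_nonoverlap[OF C p] components_nonoverlap[OF C q] by blast
  qed
  then show ?thesis using p q by blast
qed

text \<open>\<open>A\<close> and \<open>B\<close> are the complementary components of \<open>G\<close> around the two punctures.\<close>

definition ring_domain ::
  "real \<Rightarrow> real \<Rightarrow> complex set \<Rightarrow> complex set \<Rightarrow> complex set \<Rightarrow> bool" where
  "ring_domain r s G A B \<longleftrightarrow> r > 1 \<and> s > 1 \<and>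
     open G \<and> connected G \<and> closed_annulus r \<subseteq> G \<and> G \<subseteq> closed_annulus s \<and> G = - (A \<union> B) \<and>
     closed A \<and> connected A \<and> ball 0 (1 / s) \<subseteq> A \<and> A \<subseteq> ball 0 (1 / r) \<and> connected (frontier A) \<and>
     closed B \<and> connected B \<and> - cball 0 s \<subseteq> B \<and> B \<subseteq> - cball 0 r \<and> connected (frontier B)"

lemma one_in_closed_annulus: "r > 1 \<Longrightarrow> 1 \<in> closed_annulus r"
  by (simp add: closed_annulus_def)

lemma ring_domain_fill:
  assumes V: "open V" "connected V" "closed_annulus r \<subseteq> V" "V \<subseteq> closed_annulus s"
    and r: "r > 1" and s: "s > 1"
  obtains G A B where "ring_domain r s G A B" "frontier A \<subseteq> frontier V" "frontier B \<subseteq> frontier V"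
proof -
  define A where "A = connected_component_set (- V) 0"
  define B where "B = outside V"
  define G where "G = - A - B"
  have V0: "0 \<in> - V" using V(4) closed_annulus_nonzero[of s 0] s by auto
  have bV: "bounded V"
    using V(4) compact_imp_bounded[OF compact_closed_annulus] bounded_subset by blast
  have cV: "closed (- V)" using V(1) by (rule closed_Compl)
  have A: "A \<in> components (- V)" unfolding A_def components_def using V0 by blast
  have conB: "connected B" unfolding B_def using bV by (rule connected_outside) simp
  have unB: "\<not> bounded B" unfolding B_def using bV by (rule unbounded_outside)
  then have "B \<noteq> {}" by auto
  then have B: "B \<in> components (- V)"
    unfolding B_def outside_in_components using conB by (simp add: B_def)
  have conA: "connected A" using A in_components_connected by blast
  have clA: "closed A" using A closed_components[OF cV] by blast
  have clB: "closed B" using B closed_components[OF cV] by blast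
  have A0: "0 \<in> A" unfolding A_def using V0 by simp
  have A_le: "A \<subseteq> ball 0 (1 / r)"
  proof (rule ccontr)
    assume "\<not> ?thesis"
    then have "A \<inter> frontier (ball 0 (1 / r)) \<noteq> {}"
      using A0 r by (intro connected_Int_frontier[OF conA]) auto
    then obtain z where z: "z \<in> A" "cmod z = 1 / r" using r by auto
    have "1 / r \<le> 1" using r by simp
    then have "1 / r \<le> r" using r by linarith
    then have "z \<in> closed_annulus r" using z r by (simp add: closed_annulus_def)
    then show False using z(1) V(3) in_components_subset[OF A] by blast
  qed
  have B_le: "B \<subseteq> - cball 0 r"
  proof (rule ccontr)
    assume *: "\<not> ?thesis"
    have "\<not> B \<subseteq> cball 0 r" using unB bounded_subset bounded_cball by blast
    then have "B \<inter> frontier (cball 0 r) \<noteq> {}"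
      using * by (intro connected_Int_frontier[OF conB]) auto
    then obtain z where "z \<in> B" "z \<in> frontier (cball 0 r)" by blast
    then have z: "z \<in> B" "cmod z = r" using r by simp_all
    have "1 / r \<le> 1" using r by simp
    then have "1 / r \<le> r" using r by linarith
    then have "z \<in> closed_annulus r" using z r by (simp add: closed_annulus_def)
    then show False using z(1) V(3) in_components_subset[OF B] by blast
  qed
  have "1 / r < r" using r by (simp add: divide_less_eq) (meson less_1_mult)
  then have AB: "A \<inter> B = {}" using A_le B_le by fastforce
  \<comment> \<open>The complement of \<open>A\<close> is connected, and \<open>B\<close> is a
    component of what remains of it outside the connected set \<open>V\<close>; removing such a
    component keeps it connected.\<close>
  have cG: "connected G"
  proof -
    have "connected (- A)" using V(2) A by (rule component_complement_connected)
    moreover have "V \<subseteq> - A" using in_components_subset[OF A] by blast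
    moreover have "B \<in> components (- A - V)"
      using B AB unfolding in_components_maximal by (auto simp: subset_iff)
    ultimately show ?thesis unfolding G_def using component_diff_connected[of V "- A" B] V(2) by simp
  qed
  have VG: "V \<subseteq> G" unfolding G_def using in_components_subset[OF A] in_components_subset[OF B] by blast
  have A_ge: "ball 0 (1 / s) \<subseteq> A"
    unfolding A_def using s V(4)
    by (intro connected_component_maximal) (auto simp: closed_annulus_def)
  have B_ge: "- cball 0 s \<subseteq> B"
    unfolding B_def using V(4) by (intro outside_subset_convex) (auto simp: closed_annulus_def)
  have "G \<subseteq> closed_annulus s"
  proof
    fix z assume "z \<in> G"
    then have "z \<notin> ball 0 (1 / s)" "z \<notin> - cball 0 s" using A_ge B_ge unfolding G_def by blast+
    then show "z \<in> closed_annulus s" by (simp add: closed_annulus_def)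
  qed
  moreover have "open G" unfolding G_def using clA clB by (intro open_Diff) auto
  moreover have "connected (frontier A)" "connected (frontier B)"
    using V(2) A B connected_frontier_component_complement by blast+
  ultimately have "ring_domain r s G A B"
    unfolding ring_domain_def using r s cG V(3) VG clA clB conA conB A_ge A_le B_ge B_le
    by (auto simp: G_def)
  moreover have "frontier A \<subseteq> frontier V" "frontier B \<subseteq> frontier V"
    using frontier_of_components_subset[OF A] frontier_of_components_subset[OF B] by simp_all
  ultimately show thesis using that by blast
qed

lemma ring_domainD:
  assumes "ring_domain r s G A B"
  shows "r > 1" "s > 1" "open G" "connected G" "closed_annulus r \<subseteq> G" "G \<subseteq> closed_annulus s"
    "G = - (A \<union> B)" "closed A" "connected A" "ball 0 (1 / s) \<subseteq> A" "A \<subseteq> ball 0 (1 / r)"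
    "connected (frontier A)" "closed B" "connected B" "- cball 0 s \<subseteq> B" "B \<subseteq> - cball 0 r"
    "connected (frontier B)"
  using assms unfolding ring_domain_def by blast+

lemma ring_domain_disjoint:
  assumes "ring_domain r s G A B" shows "A \<inter> B = {}"
proof -
  note d = ring_domainD[OF assms]
  have "1 / r < r" using d(1) by (simp add: divide_less_eq) (meson less_1_mult)
  then show ?thesis using d(11,16) by fastforce
qed

lemma ring_domain_frontier:
  assumes "ring_domain r s G A B" shows "frontier G \<subseteq> frontier A \<union> frontier B"
  using frontier_Un_subset[of A B] ring_domainD(7)[OF assms] by (simp only: frontier_complement)

lemma ring_domain_frontier_nonempty:
  assumes "ring_domain r s G A B" shows "frontier G \<noteq> {}"
proof -
  note d = ring_domainD[OF assms]
  have "G \<noteq> {}" using one_in_closed_annulus[OF d(1)] d(5) by blast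
  moreover have "0 \<notin> G" using d(6) closed_annulus_nonzero[of s 0] d(2) by auto
  ultimately show ?thesis unfolding frontier_eq_empty by blast
qed

text \<open>On the sphere \<open>B\<close> is closed up by infinity, which is a limit of
  \<open>B\<close> because \<open>B\<close> contains the exterior of a disc. The complement of the
  ring is thus a union of two disjoint closed connected sets.\<close>

lemma ring_domain_doubly_connected:
  assumes rd: "ring_domain r s G A B"
  shows "doubly_connected_separating G"
proof -
  note d = ring_domainD[OF rd]
  let ?A = "to_sphere ` A" and ?B = "insert sphere_infinity (to_sphere ` B)"
  have A0: "0 \<in> A" using d(2,10) by auto
  have B0: "0 \<notin> B" using d(1,16) by auto
  have dis: "?A \<inter> ?B = {}"
    using ring_domain_disjoint[OF rd] image_Int[OF inj_to_sphere, of A B] to_sphere_neq_infinity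
    by (auto simp: inj_image_mem_iff[OF inj_to_sphere] dest!: sym[of sphere_infinity])
  have S: "riemann_sphere - to_sphere ` G = ?A \<union> ?B"
  proof -
    have inf: "sphere_infinity \<in> riemann_sphere" by (simp add: riemann_sphere_def sphere_infinity_def norm_Pair)
    then have 1: "riemann_sphere = insert sphere_infinity (range to_sphere)"
      unfolding range_to_sphere by blast
    have 2: "sphere_infinity \<notin> to_sphere ` G" using to_sphere_neq_infinity by (metis imageE)
    have 3: "range to_sphere - to_sphere ` G = to_sphere ` A \<union> to_sphere ` B"
      using image_set_diff[OF inj_to_sphere, of UNIV G] d(7)
      by (simp add: Compl_eq_Diff_UNIV[symmetric] image_Un)
    have "T - X = Y \<union> insert i Z" if "T = insert i P" "i \<notin> X" "P - X = Y \<union> Z"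
      for T X Y Z P :: "(complex \<times> real) set" and i
      using that by blast
    from this[OF 1 2 3] show ?thesis .
  qed
  have "bounded A" using d(11) bounded_subset bounded_ball by blast
  then have "compact A" using d(8) compact_eq_bounded_closed by blast
  then have clA: "closed ?A" by (intro compact_imp_closed compact_continuous_image continuous_intros)
  have clB0: "closure (to_sphere ` B) \<subseteq> ?B"
  proof
    fix p assume p: "p \<in> closure (to_sphere ` B)"
    have "closure (to_sphere ` B) \<subseteq> riemann_sphere"
      using range_to_sphere closed_riemann_sphere by (intro closure_minimal) auto
    then have ps: "p \<in> riemann_sphere" using p by (rule subsetD)
    show "p \<in> ?B"
    proof (rule ccontr)
      assume np: "p \<notin> ?B"
      then have "p \<in> range to_sphere" unfolding range_to_sphere using ps by simp
      then obtain w where w: "p = to_sphere w" by (rule rangeE)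
      have wB: "w \<in> - B" using np w by auto
      have "openin (top_of_set (riemann_sphere - {sphere_infinity})) (to_sphere ` (- B))"
        using homeomorphism_imp_open_map[OF homeomorphism_to_sphere, of "- B"] d(13)
        by (simp add: open_Compl)
      then obtain T where T: "open T" "to_sphere ` (- B) = (riemann_sphere - {sphere_infinity}) \<inter> T"
        unfolding openin_open by blast
      have "p \<in> to_sphere ` (- B)" using w wB by (rule image_eqI)
      then have "p \<in> T" unfolding T(2) by (rule IntD2)
      then have "to_sphere ` B \<inter> T \<noteq> {}"
        using T(1) p open_Int_closure_eq_empty[of T "to_sphere ` B"] by blast
      then obtain b where b: "b \<in> B" "to_sphere b \<in> T" by blast
      have "to_sphere b \<in> to_sphere ` (- B)"
        unfolding T(2) range_to_sphere[symmetric] using b(2) by (intro IntI rangeI)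
      then have "b \<in> - B" by (simp only: inj_image_mem_iff[OF inj_to_sphere])
      then show False using b(1) by simp
    qed
  qed
  have infB: "sphere_infinity \<in> closure (to_sphere ` B)"
  proof (rule ccontr)
    assume "sphere_infinity \<notin> closure (to_sphere ` B)"
    moreover have "to_sphere 0 \<notin> closure (to_sphere ` B)"
      using clB0 B0 to_sphere_neq_infinity[of 0] inj_image_mem_iff[OF inj_to_sphere, of 0 B] by blast
    ultimately have "bounded_in_punctured_plane B"
      unfolding bounded_in_punctured_plane_def using B0 by auto
    then obtain t where t: "t > 1" "B \<subseteq> closed_annulus t"
      unfolding bounded_in_punctured_plane_iff by blast
    let ?z = "of_real (t + s) :: complex"
    have "cmod ?z = t + s" using t(1) d(2) by (simp only: norm_of_real)
    then have "?z \<in> - cball 0 s" "?z \<notin> closed_annulus t" using t d(2) by (auto simp: closed_annulus_def)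
    then show False using t(2) d(15) by blast
  qed
  have "closure ?B = insert sphere_infinity (closure (to_sphere ` B))" by (rule closure_insert)
  then have "closure ?B \<subseteq> ?B" using clB0 by blast
  then have clB: "closed ?B" by (simp add: closure_subset_eq)
  have "connected (to_sphere ` B)"
    using d(14) by (intro connected_continuous_image continuous_intros)
  then have conB: "connected ?B"
    by (rule connected_intermediate_closure[OF _ subset_insertI insert_subsetI[OF infB closure_subset]])
  have conA: "connected ?A"
    using d(9) by (intro connected_continuous_image continuous_intros)
  have "components (riemann_sphere - to_sphere ` G) = {?A, ?B}"
    unfolding S by (rule components_Un_closed_disjoint[OF clA conA _ clB conB _ dis]) (use A0 in auto)
  moreover have "?A \<noteq> ?B" using dis by blast
  ultimately show ?thesis unfolding doubly_connected_separating_def using A0 by blast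
qed

lemma ring_domain_bounded:
  "ring_domain r s G A B \<Longrightarrow> bounded_in_punctured_plane G"
  using ring_domainD(2,6) unfolding bounded_in_punctured_plane_iff by blast


section \<open>Spiders' webs from invariant sets\<close>

text \<open>The condition \<open>trap\<close> isolates what the three sets have in common: a bounded domain whose
  forward images miss a point and follow the orbit of some \<open>a \<in> E\<close> towards the punctures
  has a boundary point in \<open>E\<close>.\<close>

locale invariant_set = punctured_dynamics +
  fixes E :: "complex set"
  assumes E_nonzero: "0 \<notin> E"
    and E_invariant: "z \<noteq> 0 \<Longrightarrow> f z \<in> E \<longleftrightarrow> z \<in> E"
    and trap: "open D \<Longrightarrow> connected D \<Longrightarrow> compact (closure D) \<Longrightarrow> 0 \<notin> closure D \<Longrightarrow>
      a \<in> D \<Longrightarrow> a \<in> E \<Longrightarrow> frontier D \<inter> E = {} \<Longrightarrow>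
      w \<noteq> 0 \<Longrightarrow> (\<And>k. w \<notin> (f ^^ k) ` D) \<Longrightarrow>
      (\<And>r. r > 1 \<Longrightarrow> \<exists>s>1. \<forall>k. (f ^^ k) a \<notin> closed_annulus s \<longrightarrow>
        (f ^^ k) ` closure D \<inter> closed_annulus r = {}) \<Longrightarrow> False"
begin

lemma E_iter: "z \<noteq> 0 \<Longrightarrow> (f ^^ k) z \<in> E \<longleftrightarrow> z \<in> E"
proof (induction k)
  case (Suc k)
  then show ?case using E_invariant[OF iter_nonzero[OF Suc.prems]] by simp
qed simp

lemma compact_iter_image:
  assumes "compact K" "0 \<notin> K"
  shows "compact ((f ^^ k) ` K)" "0 \<notin> (f ^^ k) ` K"
proof -
  show "compact ((f ^^ k) ` K)"
    using assms by (intro compact_continuous_image continuous_on_subset[OF iter_continuous]) auto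
  show "0 \<notin> (f ^^ k) ` K" using assms(2) iter_nonzero by (metis imageE)
qed

lemma ex_ring_domain:
  assumes z: "z \<in> julia_set f" and U: "open U" "z \<in> U"
    "closure (to_sphere ` U) \<inter> {to_sphere 0, sphere_infinity} = {}" "frontier U \<subseteq> E" and r: "r > 1"
  shows "\<exists>s G A B. ring_domain r s G A B \<and> frontier A \<subseteq> E \<and> frontier B \<subseteq> E"
proof -
  have "0 \<notin> U" using U(3) closure_subset[of "to_sphere ` U"] by blast
  then have "bounded_in_punctured_plane U"
    using U(3) unfolding bounded_in_punctured_plane_def by blast
  then obtain t where t: "t > 1" "U \<subseteq> closed_annulus t"
    unfolding bounded_in_punctured_plane_iff by blast
  then have clU: "closure U \<subseteq> closed_annulus t"
    by (intro closure_minimal compact_imp_closed compact_closed_annulus)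
  have cU: "compact (closure U)"
    using clU compact_imp_bounded[OF compact_closed_annulus] bounded_subset
    by (simp add: compact_eq_bounded_closed) blast
  have U0: "0 \<notin> closure U" using clU closed_annulus_nonzero[of t 0] t(1) by auto
  let ?f = "\<lambda>k. (f ^^ k) ` U"
  have op: "open (?f k)" for k using open_iter_image[OF U(1) \<open>0 \<notin> U\<close>] .
  have "closed_annulus r \<subseteq> (\<Union>k\<in>UNIV. ?f k)"
  proof
    fix w assume "w \<in> closed_annulus r"
    then have "w \<noteq> 0" using closed_annulus_nonzero[of r w] r by auto
    from julia_blow_up[OF z U(1,2) this] show "w \<in> (\<Union>k\<in>UNIV. ?f k)" by blast
  qed
  then obtain I where I: "finite I" "closed_annulus r \<subseteq> (\<Union>k\<in>I. ?f k)"
    using compactE_image[OF compact_closed_annulus, of UNIV ?f r] op by auto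
  define W where "W = (\<Union>k\<in>I. ?f k)"
  have oW: "open W" unfolding W_def using op by blast
  \<comment> \<open>The union of the images may be disconnected. The point 1 lies in every annulus
    of radius above 1, so it selects the component containing the given one.\<close>
  define V where "V = connected_component_set W 1"
  have oneW: "1 \<in> W" using I(2) one_in_closed_annulus[OF r] unfolding W_def by blast
  have V: "open V" "connected V" "V \<subseteq> W"
    using oW by (auto simp: V_def open_connected_component connected_component_subset)
  have rV: "closed_annulus r \<subseteq> V"
    unfolding V_def using I(2) one_in_closed_annulus[OF r] connected_closed_annulus
    by (intro connected_component_maximal) (auto simp: W_def)
  have "compact (\<Union>k\<in>I. (f ^^ k) ` closure U)" "0 \<notin> (\<Union>k\<in>I. (f ^^ k) ` closure U)"
    using I(1) compact_iter_image[OF cU U0] by auto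
  then obtain s where s: "s > 1" "(\<Union>k\<in>I. (f ^^ k) ` closure U) \<subseteq> closed_annulus s"
    by (rule compact_subset_closed_annulus)
  have "W \<subseteq> (\<Union>k\<in>I. (f ^^ k) ` closure U)" unfolding W_def using closure_subset by blast
  then have Vs: "V \<subseteq> closed_annulus s" using V(3) s(2) by blast
  have "frontier V \<subseteq> frontier W"
    unfolding V_def by (rule frontier_of_connected_component_subset)
  also have "\<dots> \<subseteq> (\<Union>X \<in> ?f ` I. frontier X)"
    unfolding W_def using I(1) by (intro frontier_Union_subset) simp
  also have "\<dots> \<subseteq> E"
  proof
    fix y assume "y \<in> (\<Union>X \<in> ?f ` I. frontier X)"
    then obtain k where "y \<in> frontier (?f k)" by blast
    then obtain x where x: "x \<in> frontier U" "y = (f ^^ k) x"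
      using frontier_iter_image[OF U(1) cU U0] by blast
    then have "x \<in> E" using U(4) by blast
    then show "y \<in> E" using E_iter[of x k] E_nonzero x(2) by metis
  qed
  finally have VE: "frontier V \<subseteq> E" .
  obtain G A B where "ring_domain r s G A B" "frontier A \<subseteq> frontier V" "frontier B \<subseteq> frontier V"
    by (rule ring_domain_fill[OF V(1,2) rV Vs r s(1)])
  then show ?thesis using order_trans[OF _ VE] by (intro exI conjI)
qed

text \<open>The complements of the sets \<open>B m\<close> are bounded open sets containing larger
  and larger discs, with the same frontiers as \<open>B m\<close>. It is stated for any
  \<open>g\<close> so as to apply to both \<open>f\<close> and \<open>1 / f\<close>.\<close>

lemma outer_frontier_eventually_large:
  assumes rd: "\<And>n. ring_domain (r n) (s n) (G n) (A n) (B n)" and r: "\<And>n. real n \<le> r n"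
    and g: "transcendental_self_map g"
  shows "\<exists>N. \<forall>m\<ge>N. \<exists>w\<in>frontier (B m). t < cmod (g w)"
proof (rule ccontr)
  assume "\<not> ?thesis"
  then have no: "\<exists>m\<ge>N. \<forall>w\<in>frontier (B m). cmod (g w) \<le> t" for N by (meson not_le)
  show False
  proof (rule tsm_not_bounded_on_frontiers[OF g, of "\<bar>t\<bar>"])
    fix z :: complex assume "cmod z > 1"
    obtain N :: nat where N: "cmod z < real N" using reals_Archimedean2 by blast
    obtain m where m: "m \<ge> N" "\<forall>w\<in>frontier (B m). cmod (g w) \<le> t" using no by blast
    note d = ring_domainD[OF rd[of m]]
    have "cmod z < r m" using N m(1) r[of m] by linarith
    then have "z \<in> - B m" using d(16) by auto
    moreover have "bounded (- B m)"
      using d(15) by (intro bounded_subset[OF bounded_cball[of 0 "s m"]]) blast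
    moreover have "open (- B m)" using d(13) by (rule open_Compl)
    moreover have "cmod (g w) \<le> \<bar>t\<bar> * cmod w" if "w \<in> frontier (- B m)" "cmod w \<ge> 1" for w
    proof -
      have "cmod (g w) \<le> t" using m(2) that(1) by (simp add: frontier_complement)
      also have "t \<le> \<bar>t\<bar> * 1" by simp
      also have "\<dots> \<le> \<bar>t\<bar> * cmod w" using that(2) by (intro mult_left_mono) auto
      finally show ?thesis .
    qed
    ultimately show "\<exists>H. open H \<and> bounded H \<and> z \<in> H \<and>
        (\<forall>w\<in>frontier H. 1 \<le> cmod w \<longrightarrow> cmod (g w) \<le> \<bar>t\<bar> * cmod w)" by blast
  qed
qed

text \<open>The image of a far out boundary curve is connected and reaches close to both punctures, so it
  meets every boundary curve in a given compact set.\<close>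

lemma ring_frontiers_in_connected_subset:
  assumes rd: "\<And>n. ring_domain (r n) (s n) (G n) (A n) (B n)" and r: "\<And>n. real n \<le> r n"
    and AE: "\<And>n. frontier (A n) \<subseteq> E" and BE: "\<And>n. frontier (B n) \<subseteq> E"
  obtains E0 where "connected E0" "E0 \<subseteq> E" "\<And>n. frontier (G n) \<subseteq> E0"
proof -
  \<comment> \<open>Ring 0 is a common hub: the image curve chosen for ring \<open>j\<close> must
    link ring \<open>j\<close> to it.\<close>
  have "\<exists>m. \<forall>i\<in>{0, j}. f ` frontier (B m) \<inter> frontier (A i) \<noteq> {} \<and> f ` frontier (B m) \<inter> frontier (B i) \<noteq> {}"
    for j
  proof -
    define t where "t = max (s 0) (s j)"
    have t: "t > 1" using ring_domainD(2)[OF rd[of 0]] by (auto simp: t_def)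
    obtain N1 where N1: "\<And>m. m \<ge> N1 \<Longrightarrow> \<exists>w\<in>frontier (B m). t < cmod (f w)"
      using outer_frontier_eventually_large[OF rd r tsm] by blast
    obtain N2 where N2: "\<And>m. m \<ge> N2 \<Longrightarrow> \<exists>w\<in>frontier (B m). t < cmod (1 / f w)"
      using outer_frontier_eventually_large[OF rd r tsm_inverse[OF tsm]] by blast
    define m where "m = max N1 N2"
    obtain w1 w2 where w1: "w1 \<in> frontier (B m)" "t < cmod (f w1)"
      and w2: "w2 \<in> frontier (B m)" "t < cmod (1 / f w2)"
      using N1[of m] N2[of m] by (auto simp: m_def)
    let ?Q = "f ` frontier (B m)"
    have fB0: "frontier (B m) \<subseteq> punctured_plane" using BE[of m] E_nonzero by auto
    have cQ: "connected ?Q"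
      using ring_domainD(17)[OF rd] fB0 holomorphic_on_imp_continuous_on[OF f_holomorphic]
      by (intro connected_continuous_image) (auto intro: continuous_on_subset)
    have "?Q \<inter> frontier (A i) \<noteq> {} \<and> ?Q \<inter> frontier (B i) \<noteq> {}" if i: "i \<in> {0, j}" for i
    proof -
      note d = ring_domainD[OF rd[of i]]
      have si: "s i \<le> t" using i by (auto simp: t_def)
      have "w2 \<noteq> 0" using w2(1) fB0 by auto
      then have "cmod (f w2) > 0" using f_nonzero by simp
      then have "cmod (f w2) < 1 / t" using w2(2) t by (simp add: norm_divide field_simps)
      also have "1 / t \<le> 1 / s i" using si d(2) by (intro frac_le) auto
      finally have a: "f w2 \<in> A i" using d(10) by auto
      have b: "f w1 \<in> B i" using d(15) w1(2) si by auto
      have "f w1 \<notin> A i" "f w2 \<notin> B i" using a b ring_domain_disjoint[OF rd[of i]] by auto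
      then show ?thesis
        using a b w1(1) w2(1) by (intro conjI connected_Int_frontier[OF cQ]) blast+
    qed
    then show ?thesis by blast
  qed
  then obtain m where m: "\<And>i j. i \<in> {0, j} \<Longrightarrow> f ` frontier (B (m j)) \<inter> frontier (A i) \<noteq> {}"
    "\<And>i j. i \<in> {0, j} \<Longrightarrow> f ` frontier (B (m j)) \<inter> frontier (B i) \<noteq> {}" by metis
  \<comment> \<open>The image curve meets each of the other three pieces, so \<open>T j\<close> is
    connected; all the \<open>T j\<close> share \<open>frontier (A 0)\<close>, so their union is
    connected too.\<close>
  define T where "T j = ((f ` frontier (B (m j)) \<union> frontier (A 0)) \<union> frontier (A j)) \<union> frontier (B j)" for j
  have fE: "f ` frontier (B n) \<subseteq> E" for n
  proof
    fix y assume "y \<in> f ` frontier (B n)"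
    then obtain x where x: "x \<in> frontier (B n)" "y = f x" by blast
    then have "x \<in> E" using BE by blast
    then show "y \<in> E" using E_invariant[of x] E_nonzero x(2) by metis
  qed
  have "connected (T j)" for j
  proof -
    have cQ: "connected (f ` frontier (B (m j)))"
    proof (rule connected_continuous_image)
      show "continuous_on (frontier (B (m j))) f"
        using BE E_nonzero
        by (intro continuous_on_subset[OF holomorphic_on_imp_continuous_on[OF f_holomorphic]]) auto
    qed (rule ring_domainD(17)[OF rd])
    show ?thesis
      unfolding T_def
      using cQ ring_domainD(12)[OF rd] ring_domainD(17)[OF rd] m(1)[of 0 j] m(1)[of j j] m(2)[of j j]
      by (intro connected_Un) blast+
  qed
  moreover have "frontier (A 0) \<noteq> {}" using m(1)[of 0 0] by blast
  then have "\<Inter> (range T) \<noteq> {}" by (auto simp: T_def)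
  ultimately have "connected (\<Union> (range T))" by (intro connected_Union) auto
  moreover have "\<Union> (range T) \<subseteq> E" using AE BE fE unfolding T_def by blast
  moreover have "frontier (G n) \<subseteq> \<Union> (range T)" for n
    using ring_domain_frontier[OF rd[of n]] by (auto simp: T_def)
  ultimately show thesis using that by blast
qed

lemma connected_if_ring_domains:
  assumes rd: "\<And>n. ring_domain (r n) (s n) (G n) (A n) (B n)" and r: "\<And>n. real n \<le> r n"
    and AE: "\<And>n. frontier (A n) \<subseteq> E" and BE: "\<And>n. frontier (B n) \<subseteq> E"
  shows "connected E"
proof -
  obtain E0 where E0: "connected E0" "E0 \<subseteq> E" and GE: "\<And>n. frontier (G n) \<subseteq> E0"
    using ring_frontiers_in_connected_subset[OF rd r AE BE] by blast
  have exh: "\<exists>m. closed_annulus t \<subseteq> G m" if t: "t > 1" for t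
  proof -
    obtain m :: nat where "t < real m" using reals_Archimedean2 by blast
    then have "t \<le> r m" using r[of m] by linarith
    then have "closed_annulus t \<subseteq> closed_annulus (r m)" using t by (intro closed_annulus_mono) auto
    then show ?thesis using ring_domainD(5)[OF rd[of m]] by blast
  qed
  have key: False
    if O: "open O1" "open O2" "O1 \<inter> O2 = {}" "E \<subseteq> O1 \<union> O2" "E0 \<inter> O2 = {}" and a: "a \<in> E" "a \<in> O2"
    for O1 O2 a
  proof -
    define D where "D = connected_component_set O2 a"
    have D: "open D" "connected D" "D \<subseteq> O2" "a \<in> D"
      using O(2) a(2) by (auto simp: D_def open_connected_component connected_component_subset)
    have fD: "frontier D \<inter> E = {}"
    proof -
      have "frontier D \<subseteq> frontier O2" unfolding D_def by (rule frontier_of_connected_component_subset)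
      moreover have "frontier O2 \<inter> O2 = {}" using O(2) frontier_disjoint_eq by blast
      moreover have "O1 \<inter> closure O2 = {}" using O(1,3) open_Int_closure_eq_empty by blast
      then have "O1 \<inter> frontier O2 = {}" by (auto simp: frontier_def)
      ultimately show ?thesis using O(4) by blast
    qed
    have "a \<noteq> 0" using a(1) E_nonzero by auto
    then obtain t where "t > 1" "a \<in> closed_annulus t" using closed_annulus_exhausts by metis
    then obtain m where m: "a \<in> G m" using exh by blast
    \<comment> \<open>Ring frontiers lie in \<open>E0\<close>, which misses \<open>O2\<close>. A
      component of \<open>O2\<close> therefore cannot leave a ring that it enters, and this makes
      \<open>D\<close> bounded away from the punctures.\<close>
    have "D \<inter> frontier (G m) = {}" using GE D(3) O(5) by blast
    then have "D \<subseteq> G m" using connected_Int_frontier[OF D(2), of "G m"] D(4) m by blast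
    then have Ds: "D \<subseteq> closed_annulus (s m)" using ring_domainD(6)[OF rd[of m]] by blast
    then have clD: "closure D \<subseteq> closed_annulus (s m)"
      by (intro closure_minimal compact_imp_closed compact_closed_annulus)
    have cD: "compact (closure D)"
      using clD compact_imp_bounded[OF compact_closed_annulus] bounded_subset
      by (simp add: compact_eq_bounded_closed) blast
    have D0: "0 \<notin> closure D"
      using clD closed_annulus_nonzero[of "s m" 0] ring_domainD(2)[OF rd[of m]] by auto
    have frE: "(f ^^ k) ` frontier D \<inter> E = {}" for k
    proof -
      have "(f ^^ k) x \<notin> E" if "x \<in> frontier D" for x
      proof -
        have "x \<noteq> 0" "x \<notin> E" using that D0 fD by (auto simp: frontier_def)
        then show ?thesis using E_iter by blast
      qed
      then show ?thesis by blast
    qed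
    \<comment> \<open>The frontier of the image avoids \<open>E\<close>, so an image meeting the
      connected set \<open>E0\<close> would contain all of it. But the image lies in some
      \<open>G n\<close>, whose frontier is part of \<open>E0\<close>.\<close>
    have DE0: "(f ^^ k) ` D \<inter> E0 = {}" for k
    proof (rule ccontr)
      assume ne: "(f ^^ k) ` D \<inter> E0 \<noteq> {}"
      have "frontier ((f ^^ k) ` D) \<inter> E0 = {}"
        using frontier_iter_image[OF D(1) cD D0, of k] frE[of k] E0(2) by blast
      then have sub: "E0 \<subseteq> (f ^^ k) ` D"
        using connected_Int_frontier[OF E0(1), of "(f ^^ k) ` D"] ne by blast
      obtain t where t: "t > 1" "(f ^^ k) ` closure D \<subseteq> closed_annulus t"
        using compact_subset_closed_annulus[OF compact_iter_image[OF cD D0]] by blast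
      obtain n where n: "closed_annulus t \<subseteq> G n" using exh t(1) by blast
      have "(f ^^ k) ` D \<subseteq> (f ^^ k) ` closure D" by (intro image_mono closure_subset)
      then have "frontier (G n) \<subseteq> G n"
        using order_trans[OF GE[of n] sub] order_trans[OF t(2) n] by (meson order_trans)
      moreover have "frontier (G n) \<inter> G n = {}"
        using ring_domainD(3)[OF rd[of n]] frontier_disjoint_eq by blast
      ultimately show False using ring_domain_frontier_nonempty[OF rd[of n]] by blast
    qed
    have clE0: "(f ^^ k) ` closure D \<inter> E0 = {}" for k
      unfolding closure_Un_frontier image_Un using DE0[of k] frE[of k] E0(2) by blast
    obtain w where w: "w \<in> E0"
      using ring_domain_frontier_nonempty[OF rd[of 0]] GE[of 0] by blast
    show False
    proof (rule trap[OF D(1,2) cD D0 D(4) a(1) fD, of w])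
      show "w \<noteq> 0" using w E0(2) E_nonzero by auto
      show "w \<notin> (f ^^ k) ` D" for k using DE0[of k] w by blast
      fix t :: real assume "t > 1"
      then obtain n where n: "closed_annulus t \<subseteq> G n" using exh by blast
      note d = ring_domainD[OF rd[of n]]
      \<comment> \<open>The outer radius of a ring containing the given annulus is the required
        \<open>s\<close>: once the orbit of \<open>a\<close> is outside the ring, the connected
        image, which misses the ring's frontier, is outside too.\<close>
      have "(f ^^ k) ` closure D \<inter> closed_annulus t = {}" if k: "(f ^^ k) a \<notin> closed_annulus (s n)" for k
      proof -
        have "connected ((f ^^ k) ` closure D)"
          using D0 D(2) by (intro connected_continuous_image continuous_on_subset[OF iter_continuous]
              connected_imp_connected_closure) auto
        moreover have "(f ^^ k) ` closure D \<inter> frontier (G n) = {}" using clE0[of k] GE[of n] by blast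
        moreover have "(f ^^ k) a \<in> (f ^^ k) ` closure D" using D(4) closure_subset by blast
        then have "(f ^^ k) ` closure D - G n \<noteq> {}" using k d(6) by blast
        ultimately have "(f ^^ k) ` closure D \<inter> G n = {}"
          using connected_Int_frontier[of "(f ^^ k) ` closure D" "G n"] by blast
        then show ?thesis using n by blast
      qed
      then show "\<exists>s>1. \<forall>k. (f ^^ k) a \<notin> closed_annulus s \<longrightarrow> (f ^^ k) ` closure D \<inter> closed_annulus t = {}"
        using d(2) by blast
    qed
  qed
  show ?thesis
  proof (rule ccontr)
    assume "\<not> connected E"
    then obtain P Q where P: "open P" "open Q" "E \<subseteq> P \<union> Q" "P \<inter> Q \<inter> E = {}" "P \<inter> E \<noteq> {}" "Q \<inter> E \<noteq> {}"
      unfolding connected_def by blast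
    \<comment> \<open>\<open>P\<close> and \<open>Q\<close> may overlap off \<open>E\<close>.
      Disjoint open sets are needed so that the frontier of each misses both, and hence
      \<open>E\<close>.\<close>
    have "(P \<inter> E) \<inter> closure (Q \<inter> E) = {}" "(Q \<inter> E) \<inter> closure (P \<inter> E) = {}"
      using open_Int_closure_eq_empty[OF P(1), of "Q \<inter> E"] open_Int_closure_eq_empty[OF P(2), of "P \<inter> E"] P(4)
      by blast+
    then obtain O1 O2 where O: "O1 \<inter> O2 = {}" "open O1" "open O2" "P \<inter> E \<subseteq> O1" "Q \<inter> E \<subseteq> O2"
      by (rule separation_closures)
    have cov: "E \<subseteq> O1 \<union> O2" using P(3) O(4,5) by blast
    have "E0 \<inter> O1 = {} \<or> E0 \<inter> O2 = {}"
      using connectedD[OF E0(1) O(2,3)] O(1) cov E0(2) by blast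
    then show False
    proof
      assume "E0 \<inter> O2 = {}"
      then show False using key[OF O(2,3,1) cov] P(6) O(5) by blast
    next
      assume "E0 \<inter> O1 = {}"
      then show False using key[OF O(3,2)] O(1) cov P(5) O(4) by blast
    qed
  qed
qed

lemma spiders_web_if_separates:
  assumes z: "z \<in> julia_set f"
    and sep: "separates_point_from E z {to_sphere 0, sphere_infinity}"
  shows "punctured_spiders_web E"
proof -
  obtain U where U: "open U" "z \<in> U"
    "closure (to_sphere ` U) \<inter> {to_sphere 0, sphere_infinity} = {}" "frontier U \<subseteq> E"
    using sep unfolding separates_point_from_def by blast
  have "\<forall>r. \<exists>s G A B. r > 1 \<longrightarrow> ring_domain r s G A B \<and> frontier A \<subseteq> E \<and> frontier B \<subseteq> E"
    using ex_ring_domain[OF z U] by blast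
  then obtain s G A B where rd: "\<And>r. r > 1 \<Longrightarrow> ring_domain r (s r) (G r) (A r) (B r)"
    and AE: "\<And>r. r > 1 \<Longrightarrow> frontier (A r) \<subseteq> E" and BE: "\<And>r. r > 1 \<Longrightarrow> frontier (B r) \<subseteq> E"
    by metis
  \<comment> \<open>Passing the previous outer radius makes the rings nested; adding at least 1
    makes them exhaust the punctured plane.\<close>
  define r where "r n = rec_nat 2 (\<lambda>_ x. max (s x) (x + 1)) n" for n
  have rS: "r (Suc n) = max (s (r n)) (r n + 1)" for n by (simp add: r_def)
  have rn: "real n + 2 \<le> r n" for n
    by (induction n) (auto simp: r_def)
  have r1: "r n > 1" and rn': "real n \<le> r n" for n using rn[of n] by auto
  have con: "connected E"
    by (rule connected_if_ring_domains[OF rd[OF r1] rn' AE[OF r1] BE[OF r1]])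
  have "open (G (r n)) \<and> connected (G (r n)) \<and> G (r n) \<noteq> {} \<and> bounded_in_punctured_plane (G (r n)) \<and>
      doubly_connected_separating (G (r n)) \<and> G (r n) \<subseteq> G (r (Suc n)) \<and> frontier (G (r n)) \<subseteq> E" for n
  proof (intro conjI)
    note R = rd[OF r1[of n]]
    note d = ring_domainD[OF R]
    show "open (G (r n))" "connected (G (r n))" using d by blast+
    show "G (r n) \<noteq> {}" using one_in_closed_annulus[OF d(1)] d(5) by blast
    show "bounded_in_punctured_plane (G (r n))" "doubly_connected_separating (G (r n))"
      using ring_domain_bounded[OF R] ring_domain_doubly_connected[OF R] by blast+
    have "closed_annulus (s (r n)) \<subseteq> closed_annulus (r (Suc n))"
      using d(2) by (intro closed_annulus_mono) (auto simp: rS)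
    then show "G (r n) \<subseteq> G (r (Suc n))"
      using d(6) ring_domainD(5)[OF rd[OF r1[of "Suc n"]]] by blast
    show "frontier (G (r n)) \<subseteq> E" using ring_domain_frontier[OF R] AE[OF r1] BE[OF r1] by blast
  qed
  moreover have "(\<Union>n. G (r n)) = punctured_plane"
  proof
    show "(\<Union>n. G (r n)) \<subseteq> punctured_plane"
      using ring_domain_bounded[OF rd[OF r1]] unfolding bounded_in_punctured_plane_def by blast
    show "punctured_plane \<subseteq> (\<Union>n. G (r n))"
    proof
      fix z :: complex assume "z \<in> punctured_plane"
      then obtain t where t: "t > 1" "z \<in> closed_annulus t" using closed_annulus_exhausts by auto
      obtain n :: nat where "t < real n" using reals_Archimedean2 by blast
      then have "t \<le> r n" using rn'[of n] by linarith
      then have "closed_annulus t \<subseteq> closed_annulus (r n)" using t(1) by (intro closed_annulus_mono) auto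
      then show "z \<in> (\<Union>n. G (r n))" using t(2) ring_domainD(5)[OF rd[OF r1[of n]]] by blast
    qed
  qed
  ultimately show ?thesis
    unfolding punctured_spiders_web_def using con E_nonzero by (intro conjI exI[of _ "\<lambda>n. G (r n)"]) auto
qed

end


section \<open>The three invariant sets\<close>

context punctured_dynamics
begin

lemma invariant_set_julia: "invariant_set f (julia_set f)"
proof unfold_locales
  show "0 \<notin> julia_set f" by (simp add: julia_set_def)
  show "f z \<in> julia_set f \<longleftrightarrow> z \<in> julia_set f" if "z \<noteq> 0" for z
    using that by (rule julia_set_invariant)
  fix D :: "complex set" and a w :: complex
  assume D: "open D" "a \<in> D" "a \<in> julia_set f" "w \<noteq> 0" "\<And>k. w \<notin> (f ^^ k) ` D"
  obtain k where "w \<in> (f ^^ k) ` D" using julia_blow_up[OF D(3,1,2,4)] by blast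
  then show False using D(5) by blast
qed

lemma frontier_nonempty_if_compact_closure:
  assumes "a \<in> D" "compact (closure D)"
  shows "frontier (D :: complex set) \<noteq> {}"
  using assms not_compact_UNIV[where 'a = complex] unfolding frontier_eq_empty by auto

lemma invariant_set_escaping: "invariant_set f (escaping_set f)"
proof unfold_locales
  show "0 \<notin> escaping_set f" by (simp add: escaping_set_def)
  show "f z \<in> escaping_set f \<longleftrightarrow> z \<in> escaping_set f" if "z \<noteq> 0" for z
    using that by (rule escaping_set_invariant)
  fix D :: "complex set" and a :: complex
  assume D: "compact (closure D)" "0 \<notin> closure D" "a \<in> D" and aI: "a \<in> escaping_set f"
    and fr: "frontier D \<inter> escaping_set f = {}"
    and follow: "\<And>r. r > 1 \<Longrightarrow> \<exists>s>1. \<forall>k. (f ^^ k) a \<notin> closed_annulus s \<longrightarrow>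
        (f ^^ k) ` closure D \<inter> closed_annulus r = {}"
  obtain z where z: "z \<in> frontier D" using frontier_nonempty_if_compact_closure[OF D(3,1)] by blast
  then have zc: "z \<in> closure D" by (simp add: frontier_def)
  have "\<forall>\<^sub>F k in sequentially. (f ^^ k) z \<notin> closed_annulus r" if r: "r > 1" for r
  proof -
    obtain s where s: "s > 1" "\<And>k. (f ^^ k) a \<notin> closed_annulus s \<Longrightarrow>
        (f ^^ k) ` closure D \<inter> closed_annulus r = {}" using follow[OF r] by blast
    have "\<forall>\<^sub>F k in sequentially. (f ^^ k) a \<notin> closed_annulus s"
      using aI s(1) escaping_set_iff by blast
    then show ?thesis by eventually_elim (use s(2) zc in blast)
  qed
  moreover have "z \<noteq> 0" using zc D(2) by auto
  ultimately have "z \<in> escaping_set f" unfolding escaping_set_iff by blast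
  then show False using z fr by blast
qed

end

section \<open>Trapping for the fast escaping set\<close>

context fast_escape
begin

text \<open>A point below level \<open>r\<close> but beyond \<open>R\<close> would, by strict
  monotonicity, have an image below the next level. Level bounds thus propagate backwards in
  time.\<close>

lemma flip_map_step:
  assumes x: "flip p (cmod w) \<ge> R" and "R \<le> r" and le: "max_modulus (flip_map p q f) r \<le> flip q (cmod (f w))"
  shows "r \<le> flip p (cmod w)"
proof (rule ccontr)
  assume "\<not> ?thesis"
  then have less: "flip p (cmod w) < r" by simp
  have "w \<noteq> 0" using x R_gt_1 by (cases p) auto
  have "flip q (cmod (f w)) = cmod (flip_map p q f (flip p w))" by (simp add: flip_map_def norm_flip)
  also have "\<dots> \<le> max_modulus (flip_map p q f) (cmod (flip p w))"
    using \<open>w \<noteq> 0\<close> by (intro cmod_le_max_modulus(1)[OF tsm_flip_map[OF tsm]]) simp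
  also have "\<dots> < max_modulus (flip_map p q f) r"
    unfolding norm_flip using x less by (rule max_modulus_less)
  finally show False using le by simp
qed

text \<open>The maximum principle for the iterate, or for its reciprocal when the puncture is
  \<open>0\<close>. The point found depends on \<open>k\<close>.\<close>

lemma frontier_point_above_level:
  assumes D: "open D" "compact (closure D)" "0 \<notin> closure D" "a \<in> D"
    and le: "t \<le> flip p (cmod ((f ^^ k) a))"
  shows "\<exists>z\<in>frontier D. t \<le> flip p (cmod ((f ^^ k) z))"
proof -
  let ?g = "\<lambda>z. flip p ((f ^^ k) z)"
  have sub: "closure D \<subseteq> punctured_plane" using D(3) by auto
  have hol: "?g holomorphic_on punctured_plane"
  proof (cases p)
    case Zero
    then show ?thesis
      using holomorphic_on_divide[OF holomorphic_on_const iter_holomorphic, of k 1] iter_nonzero by simp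
  qed (simp add: iter_holomorphic)
  have cg: "continuous_on (closure D) ?g"
    using holomorphic_on_imp_continuous_on[OF hol] sub continuous_on_subset by blast
  have fr: "frontier D \<subseteq> closure D" by (auto simp: frontier_def)
  have cfr: "compact (frontier D)"
    using D(2) fr by (metis compact_Int_closed frontier_closed inf.absorb2)
  obtain z where z: "z \<in> frontier D" "\<And>y. y \<in> frontier D \<Longrightarrow> cmod (?g y) \<le> cmod (?g z)"
    using continuous_attains_sup[OF cfr frontier_nonempty_if_compact_closure[OF D(4,2)],
        of "\<lambda>z. cmod (?g z)"] continuous_on_norm[OF continuous_on_subset[OF cg fr]] by blast
  have "cmod (?g a) \<le> cmod (?g z)"
  proof (rule maximum_modulus_frontier[where f = ?g and S = D])
    show "?g holomorphic_on interior D"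
      using hol sub closure_subset interior_subset by (meson holomorphic_on_subset order_trans)
    show "bounded D" using D(2) compact_imp_bounded bounded_subset closure_subset by blast
  qed (use cg z D in auto)
  then have "t \<le> flip p (cmod ((f ^^ k) z))" using le by (simp add: norm_flip)
  then show ?thesis using z(1) by blast
qed

text \<open>For each time some frontier point is above the level prescribed by the itinerary of
  \<open>a\<close>. The compact sets of such points are nested, and a common point follows the whole
  itinerary, so it lies in \<open>A\<close>.\<close>

lemma invariant_set_fast_escaping: "invariant_set f A"
proof unfold_locales
  show "0 \<notin> A" by (simp add: fast_escaping_set_def)
  show "f z \<in> A \<longleftrightarrow> z \<in> A" if "z \<noteq> 0" for z
    using that by (rule fast_escaping_set_invariant)
  fix D :: "complex set" and a :: complex
  assume D: "open D" "connected D" "compact (closure D)" "0 \<notin> closure D" "a \<in> D" and aA: "a \<in> A"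
    and frA: "frontier D \<inter> A = {}"
    and follow: "\<And>r. r > 1 \<Longrightarrow> \<exists>s>1. \<forall>k. (f ^^ k) a \<notin> closed_annulus s \<longrightarrow>
        (f ^^ k) ` closure D \<inter> closed_annulus r = {}"
  obtain l e where le: "\<And>n. L e n \<le> flip (e n) (cmod ((f ^^ (n + l)) a))"
    using aA unfolding fast_escaping_set_iff by blast
  obtain s where s: "s > 1" "\<And>k. (f ^^ k) a \<notin> closed_annulus s \<Longrightarrow>
        (f ^^ k) ` closure D \<inter> closed_annulus R = {}" using follow[OF R_gt_1] by blast
  have "a \<in> escaping_set f" using aA fast_escaping_subset_escaping by blast
  then obtain n0 where n0: "\<And>k. k \<ge> n0 \<Longrightarrow> (f ^^ k) a \<notin> closed_annulus s"
    using s(1) unfolding escaping_set_iff eventually_sequentially by blast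
  \<comment> \<open>The image of \<open>closure D\<close> is connected and misses the unit circle,
    so it lies near the same puncture as the image of \<open>a\<close>, beyond radius
    \<open>R\<close>. Without this \<open>flip_map_step\<close> could not be applied to frontier
    points.\<close>
  have side: "R \<le> flip (e n) (cmod ((f ^^ (n + l)) z))" if n: "n \<ge> n0" and z: "z \<in> closure D" for n z
  proof -
    let ?X = "(f ^^ (n + l)) ` closure D"
    have dis: "?X \<inter> closed_annulus R = {}" using n by (intro s(2) n0) simp
    have conX: "connected ?X"
      using D(2,4) by (intro connected_continuous_image continuous_on_subset[OF iter_continuous]
          connected_imp_connected_closure) auto
    have "sphere 0 1 \<subseteq> closed_annulus R" using R_gt_1 by (auto simp: closed_annulus_def)
    then have "?X \<inter> frontier (ball 0 1) = {}" using dis by auto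
    then have one: "?X \<subseteq> ball 0 1 \<or> ?X \<inter> ball 0 1 = {}"
      using connected_Int_frontier[OF conX, of "ball 0 1"] by blast
    have zX: "(f ^^ (n + l)) z \<in> ?X" and aX: "(f ^^ (n + l)) a \<in> ?X"
      using z D(5) closure_subset by blast+
    have zR: "(f ^^ (n + l)) z \<notin> closed_annulus R" using zX dis by blast
    have nz: "cmod ((f ^^ (n + l)) z) > 0" "cmod ((f ^^ (n + l)) a) > 0"
    proof -
      have "z \<noteq> 0" "a \<noteq> 0" using z D(4,5) closure_subset[of D] by auto
      then show "cmod ((f ^^ (n + l)) z) > 0" "cmod ((f ^^ (n + l)) a) > 0"
        using iter_nonzero by simp_all
    qed
    have aR: "R \<le> flip (e n) (cmod ((f ^^ (n + l)) a))" using le[of n] escape_level_ge_R[of e n] by simp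
    show ?thesis
    proof (cases "e n")
      case Infty
      then have "(f ^^ (n + l)) a \<notin> ball 0 1" using aR R_gt_1 by auto
      then have "(f ^^ (n + l)) z \<notin> ball 0 1" using one zX aX by blast
      then have "1 \<le> cmod ((f ^^ (n + l)) z)" by simp
      moreover have "1 / R \<le> 1" using R_gt_1 by simp
      ultimately show ?thesis using Infty zR by (auto simp: closed_annulus_def)
    next
      case Zero
      then have "R * cmod ((f ^^ (n + l)) a) \<le> 1" using aR nz(2) by (simp add: pos_le_divide_eq)
      moreover have "1 * cmod ((f ^^ (n + l)) a) < R * cmod ((f ^^ (n + l)) a)"
        using nz(2) R_gt_1 by (intro mult_strict_right_mono)
      ultimately have "(f ^^ (n + l)) a \<in> ball 0 1" by simp
      then have "(f ^^ (n + l)) z \<in> ball 0 1" using one zX aX by blast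
      then have "cmod ((f ^^ (n + l)) z) \<le> R" using R_gt_1 by simp
      then have "cmod ((f ^^ (n + l)) z) < 1 / R" using zR by (auto simp: closed_annulus_def)
      then show ?thesis using Zero nz(1) R_gt_1 by (simp add: field_simps)
    qed
  qed
  define C where "C i = {z \<in> frontier D. L e (n0 + i) \<le> flip (e (n0 + i)) (cmod ((f ^^ (n0 + i + l)) z))}" for i
  have fr: "frontier D \<subseteq> closure D" by (auto simp: frontier_def)
  have cfr: "compact (frontier D)"
    using D(3) fr by (metis compact_Int_closed frontier_closed inf.absorb2)
  have fr0: "z \<noteq> 0" if "z \<in> frontier D" for z using that fr D(4) by auto
  have "compact (C i)" for i
  proof -
    let ?h = "\<lambda>z. flip (e (n0 + i)) (cmod ((f ^^ (n0 + i + l)) z))"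
    have c: "continuous_on (frontier D) (\<lambda>z. cmod ((f ^^ (n0 + i + l)) z))"
      using fr0 by (intro continuous_on_norm continuous_on_subset[OF iter_continuous]) auto
    have "continuous_on (frontier D) ?h"
    proof (cases "e (n0 + i)")
      case Zero
      then show ?thesis using continuous_on_divide[OF continuous_on_const c, of 1] fr0 iter_nonzero by simp
    qed (simp add: c)
    then have "closedin (top_of_set (frontier D)) (frontier D \<inter> ?h -` {L e (n0 + i)..})"
      by (intro continuous_closedin_preimage) auto
    moreover have "frontier D \<inter> ?h -` {L e (n0 + i)..} = C i" by (auto simp: C_def)
    ultimately show ?thesis using closedin_compact[OF cfr] by simp
  qed
  moreover have "C i \<noteq> {}" for i
    using frontier_point_above_level[OF D(1,3,4,5) le[of "n0 + i"]] by (auto simp: C_def)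
  \<comment> \<open>Being above the next level forces being above the present one, so a bound at a
    late time contains all earlier ones from \<open>n0\<close> on.\<close>
  moreover have "C (Suc i) \<subseteq> C i" for i
  proof
    fix z assume z: "z \<in> C (Suc i)"
    let ?n = "n0 + i"
    have zfr: "z \<in> frontier D" using z by (simp add: C_def)
    have "L e ?n \<le> flip (e ?n) (cmod ((f ^^ (?n + l)) z))"
    proof (rule flip_map_step)
      show "R \<le> flip (e ?n) (cmod ((f ^^ (?n + l)) z))"
        using zfr fr by (intro side) auto
      show "R \<le> L e ?n" by (rule escape_level_ge_R)
      show "max_modulus (flip_map (e ?n) (e (Suc ?n)) f) (L e ?n)
          \<le> flip (e (Suc ?n)) (cmod (f ((f ^^ (?n + l)) z)))"
        using z by (simp add: C_def)
    qed
    then show "z \<in> C i" using zfr by (simp add: C_def)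
  qed
  then have "C j \<subseteq> C i" if "i \<le> j" for i j
    using that by (rule lift_Suc_antimono_le)
  ultimately have "\<Inter> (range C) \<noteq> {}" by (rule compact_nest)
  then obtain z where z: "\<And>i. z \<in> C i" by blast
  have "z \<in> A"
  proof (rule fast_escaping_eventually)
    show "z \<noteq> 0" using z[of 0] fr0 by (simp add: C_def)
    show "L e n \<le> flip (e n) (cmod ((f ^^ (n + l)) z))" if "n \<ge> n0" for n
      using z[of "n - n0"] that by (simp add: C_def)
  qed
  moreover have "z \<in> frontier D" using z[of 0] by (simp add: C_def)
  ultimately show False using frA by blast
qed

end

section \<open>From webs back to separation, and the equivalence\<close>

lemma spiders_web_domains:
  assumes "punctured_spiders_web E"
  obtains G :: "nat \<Rightarrow> complex set" where "\<And>n. open (G n)" "\<And>n. G n \<noteq> {}"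
    "\<And>n. bounded_in_punctured_plane (G n)" "\<And>n. frontier (G n) \<subseteq> E" "(\<Union>n. G n) = punctured_plane"
proof -
  obtain G :: "nat \<Rightarrow> complex set" where
    G: "\<forall>n. open (G n) \<and> connected (G n) \<and> G n \<noteq> {} \<and> bounded_in_punctured_plane (G n) \<and>
      doubly_connected_separating (G n) \<and> G n \<subseteq> G (Suc n) \<and> frontier (G n) \<subseteq> E"
    "(\<Union>n. G n) = punctured_plane"
    using assms unfolding punctured_spiders_web_def by (elim conjE exE)
  show thesis by (rule that[of G]) (simp_all add: G)
qed

lemma spiders_web_separates:
  assumes web: "punctured_spiders_web E" and J: "z \<in> julia_set f"
  shows "separates_point_from E z {to_sphere 0, sphere_infinity}"
proof -
  obtain G :: "nat \<Rightarrow> complex set" where G: "\<And>n. open (G n)" "\<And>n. bounded_in_punctured_plane (G n)"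
    "\<And>n. frontier (G n) \<subseteq> E" "(\<Union>n. G n) = punctured_plane"
    using spiders_web_domains[OF web] by metis
  have "z \<in> punctured_plane" using J by (simp add: julia_set_def)
  then obtain n where "z \<in> G n" using G(4) by blast
  then show ?thesis
    unfolding separates_point_from_def using G(1)[of n] G(2)[of n] G(3)[of n]
    by (intro exI[of _ "G n"]) (simp add: bounded_in_punctured_plane_def)
qed

lemma spiders_web_nonempty:
  assumes "punctured_spiders_web E" shows "E \<noteq> {}"
proof -
  obtain G :: "nat \<Rightarrow> complex set" where G: "G 0 \<noteq> {}" "frontier (G 0) \<subseteq> E" "(\<Union>n. G n) = punctured_plane"
    using spiders_web_domains[OF assms] by metis
  have "0 \<notin> G 0" using G(3) by blast
  then have "frontier (G 0) \<noteq> {}" using G(1) unfolding frontier_eq_empty by blast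
  then show ?thesis using G(2) by blast
qed

theorem theorem1p6:
  fixes f :: "complex \<Rightarrow> complex"
  assumes "transcendental_self_map f"
  shows "(punctured_spiders_web (escaping_set f) \<longleftrightarrow>
            (\<exists>z \<in> julia_set f.
               separates_point_from (escaping_set f) z {to_sphere 0, sphere_infinity}))
       \<and> (\<forall>\<^sub>F R in at_top.
            punctured_spiders_web (fast_escaping_set f R) \<longleftrightarrow>
            (\<exists>z \<in> julia_set f.
               separates_point_from (fast_escaping_set f R) z {to_sphere 0, sphere_infinity}))
       \<and> (punctured_spiders_web (julia_set f) \<longleftrightarrow>
            (\<exists>z \<in> julia_set f.
               separates_point_from (julia_set f) z {to_sphere 0, sphere_infinity}))"
proof -
  interpret punctured_dynamics f using assms by unfold_locales
  \<comment> \<open>The second premise supplies the Julia point that a web must separate. For the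
    two escaping sets it comes from \<open>julia_set_nonempty\<close>, since a web is nonempty and
    the fast escaping set lies in the escaping set.\<close>
  have web_iff: "punctured_spiders_web E \<longleftrightarrow>
      (\<exists>z \<in> julia_set f. separates_point_from E z {to_sphere 0, sphere_infinity})"
    if "invariant_set f E" "E \<noteq> {} \<Longrightarrow> julia_set f \<noteq> {}" for E
    using invariant_set.spiders_web_if_separates[OF that(1)] spiders_web_separates
      spiders_web_nonempty that(2) by (metis all_not_in_conv)
  have "\<forall>\<^sub>F R in at_top. punctured_spiders_web (fast_escaping_set f R) \<longleftrightarrow>
      (\<exists>z \<in> julia_set f. separates_point_from (fast_escaping_set f R) z {to_sphere 0, sphere_infinity})"
    using eventually_growth_radius[OF tsm]
  proof eventually_elim
    case (elim R)
    then interpret fast_escape f R by unfold_locales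
    show ?case
      using fast_escaping_subset_escaping julia_set_nonempty
      by (intro web_iff invariant_set_fast_escaping) blast
  qed
  then show ?thesis
    using web_iff[OF invariant_set_escaping julia_set_nonempty] web_iff[OF invariant_set_julia] by blast
qed

end
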